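(* Let $G$ be a countable, infinite group. Then: (i) For every minimal, metrizable $G$-flow $X$, there exists a minimal, metrizable, free $G$-flow $Y$ such that $X$ and $Y$ are disjoint. (ii) There exist continuum many mutually disjoint, free, metrizable, minimal $G$-flows.
   Context: A $G$-flow is a compact Hausdorff space with an action of $G$ by homeomorphisms; it is minimal if every orbit is dense, and free if for every point $x$ the map $g\mapsto g\cdot x$ is injective. Two $G$-flows $X,Y$ are disjoint if the only closed $G$-invariant subset of $X\times Y$ projecting onto both factors is $X\times Y$. A family $\{X_i:i\in I\}$ of minimal $G$-flows is mutually disjoint if the product $\prod_{i\in I}X_i$ (with the diagonal action) is minimal. *)

theory Defs
  imports "HOL-Analysis.Analysis" "HOL-Algebra.Group"
begin

text \<open>A G-flow: a nonempty compact Hausdorff space X with a (left) action a of the group G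
  by continuous maps (hence homeomorphisms, since a g has continuous inverse a (inv g)).\<close>
definition G_flow :: "('g, 'b) monoid_scheme \<Rightarrow> 'x topology \<Rightarrow> ('g \<Rightarrow> 'x \<Rightarrow> 'x) \<Rightarrow> bool" where
  "G_flow G X a \<longleftrightarrow> group G \<and> compact_space X \<and> Hausdorff_space X \<and> topspace X \<noteq> {} \<and>
     (\<forall>g\<in>carrier G. continuous_map X X (a g)) \<and>
     (\<forall>x\<in>topspace X. a \<one>\<^bsub>G\<^esub> x = x) \<and>
     (\<forall>g\<in>carrier G. \<forall>h\<in>carrier G. \<forall>x\<in>topspace X. a (g \<otimes>\<^bsub>G\<^esub> h) x = a g (a h x))"

definition orbit :: "('g, 'b) monoid_scheme \<Rightarrow> ('g \<Rightarrow> 'x \<Rightarrow> 'x) \<Rightarrow> 'x \<Rightarrow> 'x set" where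
  "orbit G a x = (\<lambda>g. a g x) ` carrier G"

definition minimal_flow :: "('g, 'b) monoid_scheme \<Rightarrow> 'x topology \<Rightarrow> ('g \<Rightarrow> 'x \<Rightarrow> 'x) \<Rightarrow> bool" where
  "minimal_flow G X a \<longleftrightarrow> G_flow G X a \<and>
     (\<forall>x\<in>topspace X. X closure_of (orbit G a x) = topspace X)"

definition free_flow :: "('g, 'b) monoid_scheme \<Rightarrow> 'x topology \<Rightarrow> ('g \<Rightarrow> 'x \<Rightarrow> 'x) \<Rightarrow> bool" where
  "free_flow G X a \<longleftrightarrow> G_flow G X a \<and> (\<forall>x\<in>topspace X. inj_on (\<lambda>g. a g x) (carrier G))"

definition disjoint_flows :: "('g, 'b) monoid_scheme \<Rightarrow> 'x topology \<Rightarrow> ('g \<Rightarrow> 'x \<Rightarrow> 'x)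
    \<Rightarrow> 'y topology \<Rightarrow> ('g \<Rightarrow> 'y \<Rightarrow> 'y) \<Rightarrow> bool" where
  "disjoint_flows G X a Y b \<longleftrightarrow>
     (\<forall>Z. closedin (prod_topology X Y) Z \<and>
          (\<forall>g\<in>carrier G. \<forall>p\<in>Z. (a g (fst p), b g (snd p)) \<in> Z) \<and>
          fst ` Z = topspace X \<and> snd ` Z = topspace Y
          \<longrightarrow> Z = topspace X \<times> topspace Y)"

definition diag_action :: "'i set \<Rightarrow> ('i \<Rightarrow> 'g \<Rightarrow> 'x \<Rightarrow> 'x) \<Rightarrow> 'g \<Rightarrow> ('i \<Rightarrow> 'x) \<Rightarrow> ('i \<Rightarrow> 'x)" where
  "diag_action I a g f = (\<lambda>i\<in>I. a i g (f i))"

definition mutually_disjoint :: "('g, 'b) monoid_scheme \<Rightarrow> 'i set \<Rightarrow> ('i \<Rightarrow> 'x topology)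
    \<Rightarrow> ('i \<Rightarrow> 'g \<Rightarrow> 'x \<Rightarrow> 'x) \<Rightarrow> bool" where
  "mutually_disjoint G I X a \<longleftrightarrow>
     (\<forall>i\<in>I. minimal_flow G (X i) (a i)) \<and>
     minimal_flow G (product_topology X I) (diag_action I a)"

end

theory Submission
  imports Defs
begin

text \<open>
  Call a shift-invariant set of configurations irreducible if partial configurations at positions
  further than \<open>\<rho>\<close> apart can always be pasted. Given such a set \<open>Z\<close> and a pattern \<open>w\<close>, one shrinks \<open>Z\<close> to an
  irreducible \<open>Z'\<close> such that for every point \<open>x\<close> of a minimal flow, every open \<open>U\<close> and every \<open>z \<in> Z'\<close> some \<open>g\<close>
  brings \<open>x\<close> into \<open>U\<close> and \<open>z\<close> into the cylinder of \<open>w\<close>. For this choose a large separated set \<open>P\<close> of return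
  times of one point to \<open>U\<close>; by minimality the return times of every \<open>x\<close> contain a translate \<open>P t\<close>
  with \<open>t\<close> in a given right translate of a fixed finite set. A counting argument in place of the local
  lemma gives a separated set \<open>S\<close> that meets all these translates, hence all sets of return times, and
  \<open>Z'\<close> consists of the points that carry \<open>w\<close> along translates of \<open>S\<close> in a syndetic way.
  Intersecting a decreasing sequence of such sets gives a minimal flow disjoint from the given one.
  Running the construction along a binary tree, with the sets at the other nodes of a level playing the
  role of the minimal flow, gives continuum many mutually disjoint flows. Freeness is enforced by
  requiring a proper 3-colouring of the Cayley graph of each nontrivial element.
\<close>

section \<open>Avoiding bad patterns by counting\<close>

definition avoiders :: "'i set \<Rightarrow> ('i \<Rightarrow> 'v set) \<Rightarrow> ('i \<Rightarrow> 'v set set) \<Rightarrow> 'v set \<Rightarrow> 'v set set" where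
  "avoiders T W Bd A = {L. L \<subseteq> A \<and> (\<forall>t\<in>T. W t \<subseteq> A \<longrightarrow> L \<inter> W t \<notin> Bd t)}"

lemma finite_avoiders: "finite A \<Longrightarrow> finite (avoiders T W Bd A)"
  by (rule finite_subset[of _ "Pow A"]) (auto simp: avoiders_def)

text \<open>Rosenfeld's counting argument: each new vertex multiplies the number of admissible subsets by at
  least \<open>\<beta>\<close>, because an extension that creates a bad pattern on \<open>W t\<close> is determined by that pattern and
  by its restriction to \<open>A - W t\<close>, of which there are at most \<open>\<beta> ^ -(w - 1)\<close> times as many as for \<open>A\<close>.\<close>

lemma avoiders_card_step:
  fixes \<beta> :: real
  assumes T: "finite T" and w: "\<And>t. t \<in> T \<Longrightarrow> finite (W t) \<and> card (W t) = w"
    and Bd: "\<And>t. t \<in> T \<Longrightarrow> finite (Bd t) \<and> card (Bd t) \<le> m \<and> Bd t \<subseteq> Pow (W t)"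
    and deg: "\<And>v. card {t\<in>T. v \<in> W t} \<le> \<Delta>"
    and \<beta>: "\<beta> > 0" "\<beta> + real \<Delta> * real m / \<beta> ^ (w - 1) \<le> 2"
    and A: "finite A" "v \<notin> A"
  shows "\<beta> * card (avoiders T W Bd A) \<le> card (avoiders T W Bd (insert v A))"
  using A
proof (induction "card A" arbitrary: A v rule: less_induct)
  case less
  let ?c = "\<lambda>A. real (card (avoiders T W Bd A))"
  have IH: "\<beta> ^ card D * ?c B \<le> ?c (B \<union> D)" if "finite D" "finite B" "B \<inter> D = {}" "B \<union> D \<subseteq> A" for B D
    using that
  proof (induction D rule: finite_induct)
    case (insert x D)
    have "card (B \<union> D) < card A"
      using insert less.prems by (intro psubset_card_mono) auto
    then have "\<beta> * ?c (B \<union> D) \<le> ?c (insert x (B \<union> D))"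
      using insert by (intro less.hyps) auto
    moreover have "\<beta> * (\<beta> ^ card D * ?c B) \<le> \<beta> * ?c (B \<union> D)"
      using insert \<beta> by (intro mult_left_mono) auto
    ultimately show ?case using insert by (simp add: mult.assoc)
  qed simp
  define E where "E = {t\<in>T. v \<in> W t \<and> W t \<subseteq> insert v A}"
  define X where "X t = {L. L \<subseteq> insert v A \<and> L - {v} \<in> avoiders T W Bd A \<and> L \<inter> W t \<in> Bd t}" for t
  define Y where "Y = {L. L \<subseteq> insert v A \<and> L - {v} \<in> avoiders T W Bd A}"
  have finE: "finite E" using T by (auto simp: E_def)
  have finY: "finite Y" using less.prems by (auto simp: Y_def)
  have Xsub: "X t \<subseteq> Y" for t by (auto simp: X_def Y_def)
  have "Y = avoiders T W Bd A \<union> insert v ` avoiders T W Bd A"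
  proof (intro equalityI subsetI)
    fix L assume "L \<in> Y"
    then have L: "L - {v} \<in> avoiders T W Bd A" by (simp add: Y_def)
    show "L \<in> avoiders T W Bd A \<union> insert v ` avoiders T W Bd A"
    proof (cases "v \<in> L")
      case True
      then have "L = insert v (L - {v})" by blast
      with L show ?thesis by blast
    qed (use L in simp)
  next
    fix L assume "L \<in> avoiders T W Bd A \<union> insert v ` avoiders T W Bd A"
    then obtain L' where L': "L' \<in> avoiders T W Bd A" "L = L' \<or> L = insert v L'" by blast
    then have "L' \<subseteq> A" by (simp add: avoiders_def)
    with L' less.prems have "L - {v} = L'" "L \<subseteq> insert v A" by auto
    with L' show "L \<in> Y" by (simp add: Y_def)
  qed
  moreover have "avoiders T W Bd A \<inter> insert v ` avoiders T W Bd A = {}"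
    using less.prems by (auto simp: avoiders_def)
  ultimately have "card Y = card (avoiders T W Bd A) + card (insert v ` avoiders T W Bd A)"
    using less.prems by (simp add: card_Un_disjoint finite_avoiders)
  moreover have "inj_on (insert v) (avoiders T W Bd A)"
    using less.prems by (intro inj_onI) (auto simp: avoiders_def)
  ultimately have cY: "real (card Y) = 2 * ?c A" by (simp add: card_image)
  have sub: "Y - (\<Union>t\<in>E. X t) \<subseteq> avoiders T W Bd (insert v A)"
  proof
    fix L assume L: "L \<in> Y - (\<Union>t\<in>E. X t)"
    have "L \<inter> W t \<notin> Bd t" if t: "t \<in> T" "W t \<subseteq> insert v A" for t
    proof (cases "v \<in> W t")
      case True
      with t L show ?thesis by (auto simp: E_def X_def Y_def)
    next
      case False
      then have "W t \<subseteq> A" "(L - {v}) \<inter> W t = L \<inter> W t" using t by auto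
      with L t show ?thesis by (auto simp: Y_def avoiders_def)
    qed
    with L show "L \<in> avoiders T W Bd (insert v A)" by (auto simp: avoiders_def Y_def)
  qed
  have Xcard: "real (card (X t)) \<le> m * (?c A / \<beta> ^ (w - 1))" if t: "t \<in> E" for t
  proof -
    have tT: "t \<in> T" "v \<in> W t" "W t \<subseteq> insert v A" using t by (auto simp: E_def)
    have "card (X t) \<le> card (avoiders T W Bd (A - W t) \<times> Bd t)"
    proof (rule card_inj_on_le[where f = "\<lambda>L. (L - W t, L \<inter> W t)"])
      show "inj_on (\<lambda>L. (L - W t, L \<inter> W t)) (X t)" by (auto simp: inj_on_def)
      show "(\<lambda>L. (L - W t, L \<inter> W t)) ` X t \<subseteq> avoiders T W Bd (A - W t) \<times> Bd t"
      proof clarify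
        fix L assume L: "L \<in> X t"
        have "(L - W t) \<inter> W u \<notin> Bd u" if u: "u \<in> T" "W u \<subseteq> A - W t" for u
        proof -
          have "(L - W t) \<inter> W u = (L - {v}) \<inter> W u" using u tT by auto
          then show ?thesis using L u by (auto simp: X_def avoiders_def)
        qed
        then show "L - W t \<in> avoiders T W Bd (A - W t) \<and> L \<inter> W t \<in> Bd t"
          using L tT by (auto simp: X_def avoiders_def)
      qed
      show "finite (avoiders T W Bd (A - W t) \<times> Bd t)"
        using less.prems Bd tT by (auto simp: finite_avoiders)
    qed
    then have 1: "real (card (X t)) \<le> ?c (A - W t) * real (card (Bd t))"
      by (simp add: card_cartesian_product flip: of_nat_mult)
    have Diff_Int_Un: "A - W t \<union> A \<inter> W t = A" "(A - W t) \<inter> (A \<inter> W t) = {}" by auto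
    have "card (A \<inter> W t) = w - 1"
    proof -
      have "A \<inter> W t = W t - {v}" using tT less.prems by auto
      then show ?thesis using w tT by simp
    qed
    then have "\<beta> ^ (w - 1) * ?c (A - W t) \<le> ?c A"
      using IH[of "A \<inter> W t" "A - W t"] less.prems(1) unfolding Diff_Int_Un by simp
    then have 2: "?c (A - W t) \<le> ?c A / \<beta> ^ (w - 1)"
      using \<beta> by (simp add: field_simps)
    have "?c (A - W t) * real (card (Bd t)) \<le> ?c A / \<beta> ^ (w - 1) * real m"
      using 2 Bd tT \<beta> by (intro mult_mono) auto
    with 1 show ?thesis by (simp add: mult.commute)
  qed
  have "real (card (\<Union>t\<in>E. X t)) \<le> (\<Sum>t\<in>E. real (card (X t)))"
    using card_UN_le[OF finE, of X] by (simp flip: of_nat_sum)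
  also have "\<dots> \<le> (\<Sum>t\<in>E. m * (?c A / \<beta> ^ (w - 1)))"
    by (intro sum_mono Xcard)
  also have "\<dots> = real (card E) * (m * (?c A / \<beta> ^ (w - 1)))" by simp
  also have "\<dots> \<le> real \<Delta> * (m * (?c A / \<beta> ^ (w - 1)))"
  proof (intro mult_right_mono)
    have "card E \<le> card {t\<in>T. v \<in> W t}" using T by (intro card_mono) (auto simp: E_def)
    then show "real (card E) \<le> real \<Delta>" using deg[of v] by linarith
  qed (use \<beta> in auto)
  finally have U: "real (card (\<Union>t\<in>E. X t)) \<le> (real \<Delta> * real m / \<beta> ^ (w - 1)) * ?c A" by simp
  have "\<beta> * ?c A \<le> (2 - real \<Delta> * real m / \<beta> ^ (w - 1)) * ?c A"
    using \<beta> by (intro mult_right_mono) auto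
  also have "\<dots> \<le> real (card Y) - real (card (\<Union>t\<in>E. X t))" using U cY by (simp add: algebra_simps)
  also have "\<dots> \<le> real (card (Y - (\<Union>t\<in>E. X t)))"
  proof -
    have "card (Y - (\<Union>t\<in>E. X t)) = card Y - card (\<Union>t\<in>E. X t)"
      using Xsub finY by (intro card_Diff_subset) (auto intro: finite_subset)
    then show ?thesis by simp
  qed
  also have "\<dots> \<le> ?c (insert v A)"
    using card_mono[OF finite_avoiders sub] less.prems by simp
  finally show ?case .
qed

lemma avoiders_nonempty:
  fixes \<beta> :: real
  assumes T: "finite T" and w: "\<And>t. t \<in> T \<Longrightarrow> finite (W t) \<and> card (W t) = w" "w > 0"
    and Bd: "\<And>t. t \<in> T \<Longrightarrow> finite (Bd t) \<and> card (Bd t) \<le> m \<and> Bd t \<subseteq> Pow (W t)"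
    and deg: "\<And>v. card {t\<in>T. v \<in> W t} \<le> \<Delta>"
    and \<beta>: "\<beta> > 0" "\<beta> + real \<Delta> * real m / \<beta> ^ (w - 1) \<le> 2"
    and A: "finite A"
  shows "avoiders T W Bd A \<noteq> {}"
  using A
proof (induction A rule: finite_induct)
  case empty
  have "W t \<noteq> {}" if "t \<in> T" for t using w that by fastforce
  then show ?case by (auto simp: avoiders_def)
next
  case (insert v A)
  then have "real (card (avoiders T W Bd A)) > 0" by (simp add: finite_avoiders card_gt_0_iff)
  with avoiders_card_step[OF T w(1) Bd deg \<beta> insert.hyps(1,2)] \<beta>(1)
  have "real (card (avoiders T W Bd (insert v A))) > 0"
    by (smt (verit) mult_pos_pos)
  then show ?case by force
qed

section \<open>Countable groups with a proper length function\<close>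

text \<open>A countable infinite group is transported to the natural numbers, so that its elements can serve
  as indices of the coordinates of a point of \<open>nat \<Rightarrow> real\<close>.\<close>

locale nat_group = Groups.group mul e iv
  for mul :: "nat \<Rightarrow> nat \<Rightarrow> nat" (infixl "\<cdot>" 70) and e :: nat and iv :: "nat \<Rightarrow> nat"
begin

declare inverse_distrib_swap [simp] assoc [simp]

lemma cancel_inv [simp]: "iv a \<cdot> (a \<cdot> b) = b" "a \<cdot> (iv a \<cdot> b) = b"
  by (simp_all flip: assoc)

lemma mul_eq_iff [simp]: "a \<cdot> b = a \<cdot> c \<longleftrightarrow> b = c" "b \<cdot> a = c \<cdot> a \<longleftrightarrow> b = c"
  by (simp_all add: left_cancel right_cancel)

text \<open>Words of weight at most \<open>n\<close>, where the letter \<open>k\<close> and its inverse have weight \<open>k + 1\<close>; only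
  finitely many letters have a given weight, which makes the word length proper.\<close>

inductive reach :: "nat \<Rightarrow> nat \<Rightarrow> bool" where
  "reach n e"
| "reach n g \<Longrightarrow> n + Suc k \<le> m \<Longrightarrow> reach m (k \<cdot> g)"
| "reach n g \<Longrightarrow> n + Suc k \<le> m \<Longrightarrow> reach m (iv k \<cdot> g)"

lemma reach_mono: "reach n g \<Longrightarrow> n \<le> m \<Longrightarrow> reach m g"
proof (induction rule: reach.induct)
  case (2 n g k l)
  then show ?case using reach.intros(2)[of n g k m] by simp
next
  case (3 n g k l)
  then show ?case using reach.intros(3)[of n g k m] by simp
qed (rule reach.intros)

lemma reach_mul: "reach n g \<Longrightarrow> reach m h \<Longrightarrow> reach (n + m) (g \<cdot> h)"
proof (induction rule: reach.induct)
  case (1 n)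
  then show ?case by (auto intro: reach_mono)
next
  case (2 n g k l)
  then show ?case using reach.intros(2)[of "n + m" "g \<cdot> h" k "l + m"] by simp
next
  case (3 n g k l)
  then show ?case using reach.intros(3)[of "n + m" "g \<cdot> h" k "l + m"] by simp
qed

lemma reach_letter: "reach (Suc k) k" "reach (Suc k) (iv k)"
  using reach.intros(2)[OF reach.intros(1)[of 0], of k "Suc k"]
    reach.intros(3)[OF reach.intros(1)[of 0], of k "Suc k"] by simp_all

lemma reach_inv: "reach n g \<Longrightarrow> reach n (iv g)"
proof (induction rule: reach.induct)
  case (2 n g k m)
  then show ?case using reach_mul[OF 2(3) reach_letter(2)[of k]] by (auto intro: reach_mono)
next
  case (3 n g k m)
  then show ?case using reach_mul[OF 3(3) reach_letter(1)[of k]] by (auto intro: reach_mono)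
qed (auto intro: reach.intros)

lemma finite_reach: "finite {g. reach n g}"
proof (induction n rule: less_induct)
  case (less n)
  have "{g. reach n g} \<subseteq> insert e (\<Union>j<n. \<Union>k<n. ((\<cdot>) k ` {g. reach j g} \<union> (\<cdot>) (iv k) ` {g. reach j g}))"
    (is "_ \<subseteq> ?R")
  proof
    fix g assume "g \<in> {g. reach n g}"
    then have "reach n g" by simp
    then show "g \<in> ?R"
    proof cases
      case (2 j h k)
      then have "j < n" "k < n" by auto
      with 2 show ?thesis by blast
    next
      case (3 j h k)
      then have "j < n" "k < n" by auto
      with 3 show ?thesis by blast
    qed simp
  qed
  moreover have "finite ?R" using less by auto
  ultimately show ?case by (rule finite_subset)
qed

definition len :: "nat \<Rightarrow> nat" where "len g = (LEAST n. reach n g)"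

lemma len_le_iff: "len g \<le> n \<longleftrightarrow> reach n g"
proof
  have "reach (len g) g" unfolding len_def by (rule LeastI) (rule reach_letter)
  then show "reach n g" if "len g \<le> n" using that reach_mono by blast
qed (simp add: len_def Least_le)

lemma len_e [simp]: "len e = 0"
  using len_le_iff[of e 0] reach.intros(1) by simp

lemma len_mul: "len (g \<cdot> h) \<le> len g + len h"
  using reach_mul[of "len g" g "len h" h] by (simp flip: len_le_iff)

lemma len_inv [simp]: "len (iv g) = len g"
proof -
  have "len (iv g) \<le> len g" for g using reach_inv[of "len g" g] by (simp flip: len_le_iff)
  from this[of g] this[of "iv g"] show ?thesis by simp
qed

lemma finite_len: "finite {g. len g \<le> n}"
  by (simp add: len_le_iff finite_reach)

definition gd :: "nat \<Rightarrow> nat \<Rightarrow> nat" where "gd g h = len (g \<cdot> iv h)"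

lemma gd_refl [simp]: "gd g g = 0"
  by (simp add: gd_def)

lemma gd_commute: "gd g h = gd h g"
  using len_inv[of "g \<cdot> iv h"] by (simp add: gd_def)

lemma gd_triangle: "gd a c \<le> gd a b + gd b c"
  using len_mul[of "a \<cdot> iv b" "b \<cdot> iv c"] by (simp add: gd_def)

lemma gd_right [simp]: "gd (a \<cdot> g) (b \<cdot> g) = gd a b"
  by (simp add: gd_def)

lemma gd_mul_self [simp]: "gd (a \<cdot> g) g = len a" "gd g (a \<cdot> g) = len a"
  by (simp_all add: gd_def)

lemma gd_e [simp]: "gd a e = len a" "gd e a = len a"
  by (simp_all add: gd_def)

definition ball :: "nat \<Rightarrow> nat \<Rightarrow> nat set" where "ball g r = {h. gd h g \<le> r}"

lemma ball_eq_image: "ball g r = (\<lambda>h. h \<cdot> g) ` {h. len h \<le> r}"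
proof -
  have "h \<in> (\<lambda>h. h \<cdot> g) ` {h. len h \<le> r}" if "h \<in> ball g r" for h
    using that by (intro image_eqI[of _ _ "h \<cdot> iv g"]) (auto simp: ball_def gd_def)
  then show ?thesis by (auto simp: ball_def)
qed

lemma finite_ball: "finite (ball g r)"
  by (simp add: ball_eq_image finite_len)

lemma card_ball: "card (ball g r) = card {h. len h \<le> r}"
  unfolding ball_eq_image by (intro card_image) (auto simp: inj_on_def)

lemma center_in_ball: "g \<in> ball g r"
  by (simp add: ball_def)

definition separated :: "nat \<Rightarrow> nat set \<Rightarrow> bool" where
  "separated r S \<longleftrightarrow> (\<forall>s\<in>S. \<forall>t\<in>S. gd s t \<le> r \<longrightarrow> s = t)"

lemma separatedD: "separated r S \<Longrightarrow> s \<in> S \<Longrightarrow> t \<in> S \<Longrightarrow> gd s t \<le> r \<Longrightarrow> s = t"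
  by (auto simp: separated_def)

lemma separated_mono: "separated r S \<Longrightarrow> T \<subseteq> S \<Longrightarrow> r' \<le> r \<Longrightarrow> separated r' T"
  by (auto simp: separated_def) (meson le_trans subsetD)

text \<open>\<open>S\<close> consists of the points of a set \<open>L\<close> that are isolated in \<open>L\<close> at scale \<open>q\<close>. For a random \<open>L\<close> the
  events that the points of \<open>P \<cdot> t\<close> are isolated are independent, since the balls around them are disjoint.\<close>

lemma exists_hitting_set:
  "\<exists>N. \<forall>P T. card P = N \<longrightarrow> finite P \<longrightarrow> separated (2 * q) P \<longrightarrow> finite T \<longrightarrow>
     (\<exists>S. finite S \<and> separated q S \<and> (\<forall>t\<in>T. \<exists>p\<in>P. p \<cdot> t \<in> S))"
proof -
  define b where "b = card {h. len h \<le> q}"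
  have b: "b > 0" unfolding b_def by (subst card_gt_0_iff) (auto simp: finite_len intro: exI[of _ e])
  define B :: real where "B = 2 ^ b - 1 / 2"
  define \<beta> where "\<beta> = root b B"
  have "(2::real) \<le> 2 ^ b" using b by (intro self_le_power) auto
  then have B: "B \<ge> 1" "B < 2 ^ b" "B > 0" by (auto simp: B_def)
  have \<beta>: "\<beta> > 0" "\<beta> ^ b = B" "\<beta> \<ge> 1" using b B by (auto simp: \<beta>_def)
  have "\<beta> < 2" using B(2) \<beta> power_less_imp_less_base[of \<beta> b 2] by auto
  define x where "x = (2 ^ b - 1) / B"
  have x: "0 \<le> x" "x < 1" using B b by (auto simp: x_def B_def)
  have "(\<lambda>n. real n * x ^ n) \<longlonglongrightarrow> 0" using powser_times_n_limit_0[of x] x by simp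
  then have "(\<lambda>n. real b * \<beta> * (real n * x ^ n)) \<longlonglongrightarrow> 0" using tendsto_mult_right_zero by blast
  then have "\<forall>\<^sub>F n in sequentially. real b * \<beta> * (real n * x ^ n) < 2 - \<beta>"
    using \<open>\<beta> < 2\<close> order_tendstoD(2)[of _ 0 sequentially "2 - \<beta>"] by simp
  then have "\<forall>\<^sub>F n in sequentially. real b * \<beta> * (real n * x ^ n) < 2 - \<beta> \<and> n > 0"
    using eventually_gt_at_top[of "0::nat"] by eventually_elim simp
  then obtain N where N: "real b * \<beta> * (real N * x ^ N) < 2 - \<beta>" "N > 0"
    unfolding eventually_sequentially by blast
  show ?thesis
  proof (intro exI[of _ N] allI impI)
    fix P T :: "nat set"
    assume P: "card P = N" "finite P" "separated (2 * q) P" and T: "finite T"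
    define W where "W t = (\<Union>p\<in>P. ball (p \<cdot> t) q)" for t
    define Bd where "Bd t = {L. L \<subseteq> W t \<and> (\<forall>p\<in>P. L \<inter> ball (p \<cdot> t) q \<noteq> {p \<cdot> t})}" for t
    have finW: "finite (W t)" for t using P by (auto simp: W_def finite_ball)
    have disj: "ball (p \<cdot> t) q \<inter> ball (p' \<cdot> t) q = {}" if "p \<in> P" "p' \<in> P" "p \<noteq> p'" for p p' t
    proof (rule ccontr)
      assume "ball (p \<cdot> t) q \<inter> ball (p' \<cdot> t) q \<noteq> {}"
      then obtain h where "gd h (p \<cdot> t) \<le> q" "gd h (p' \<cdot> t) \<le> q" by (auto simp: ball_def)
      then have "gd p p' \<le> 2 * q"
        using gd_triangle[of "p \<cdot> t" "p' \<cdot> t" h] gd_commute[of h "p \<cdot> t"] by simp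
      with that separatedD[OF P(3)] show False by blast
    qed
    have cW: "card (W t) = b * N" for t
      unfolding W_def using P disj
      by (subst card_UN_disjoint) (auto simp: finite_ball card_ball b_def)
    have cBd: "card (Bd t) \<le> (2 ^ b - 1) ^ N" for t
    proof -
      let ?F = "\<Pi>\<^sub>E p\<in>P. Pow (ball (p \<cdot> t) q) - {{p \<cdot> t}}"
      have "card (Bd t) \<le> card ?F"
      proof (rule card_inj_on_le[where f = "\<lambda>L. \<lambda>p\<in>P. L \<inter> ball (p \<cdot> t) q"])
        show "inj_on (\<lambda>L. \<lambda>p\<in>P. L \<inter> ball (p \<cdot> t) q) (Bd t)"
        proof (rule inj_onI)
          fix L L' assume L: "L \<in> Bd t" "L' \<in> Bd t"
            and eq: "(\<lambda>p\<in>P. L \<inter> ball (p \<cdot> t) q) = (\<lambda>p\<in>P. L' \<inter> ball (p \<cdot> t) q)"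
          have "L \<inter> ball (p \<cdot> t) q = L' \<inter> ball (p \<cdot> t) q" if "p \<in> P" for p
            using fun_cong[OF eq, of p] that by simp
          then have "L \<inter> W t = L' \<inter> W t" unfolding W_def by blast
          with L show "L = L'" unfolding Bd_def by blast
        qed
        show "finite ?F" using P by (intro finite_PiE) (auto simp: finite_ball)
      qed (auto simp: Bd_def)
      also have "card ?F = (\<Prod>p\<in>P. 2 ^ b - 1)"
        using P by (simp add: card_PiE card_Pow finite_ball card_ball b_def center_in_ball)
      finally show ?thesis using P by simp
    qed
    have deg: "card {t\<in>T. v \<in> W t} \<le> N * b" for v
    proof -
      have "{t\<in>T. v \<in> W t} \<subseteq> (\<lambda>(p, y). iv p \<cdot> iv y \<cdot> v) ` (P \<times> {h. len h \<le> q})"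
        by (force simp: W_def ball_eq_image image_iff)
      then have "card {t\<in>T. v \<in> W t} \<le> card (P \<times> {h. len h \<le> q})"
        using P finite_len by (meson card_image_le card_mono finite_SigmaI finite_imageI le_trans)
      then show ?thesis using P by (simp add: card_cartesian_product b_def)
    qed
    have "real (N * b) * real ((2 ^ b - 1) ^ N) / \<beta> ^ (b * N - 1) = real b * \<beta> * (real N * x ^ N)"
    proof -
      have "\<beta> ^ (b * N) = \<beta> * \<beta> ^ (b * N - 1)" using b N by (simp flip: power_Suc)
      moreover have "\<beta> ^ (b * N) = B ^ N" by (simp add: power_mult \<beta>(2))
      ultimately have inv: "1 / \<beta> ^ (b * N - 1) = \<beta> / B ^ N" using \<beta>(1) B by (simp add: field_simps)
      have "real (N * b) * real ((2 ^ b - 1) ^ N) / \<beta> ^ (b * N - 1)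
          = real (N * b) * (2 ^ b - 1) ^ N * (1 / \<beta> ^ (b * N - 1))"
        by (simp add: of_nat_diff)
      also have "\<dots> = real b * \<beta> * (real N * x ^ N)"
        unfolding inv by (simp add: x_def power_divide)
      finally show ?thesis .
    qed
    with N have le: "\<beta> + real (N * b) * real ((2 ^ b - 1) ^ N) / \<beta> ^ (b * N - 1) \<le> 2" by simp
    define A where "A = (\<Union>t\<in>T. W t)"
    have "avoiders T W Bd A \<noteq> {}"
    proof (rule avoiders_nonempty[OF T _ _ _ deg \<beta>(1) le])
      show "finite (Bd t) \<and> card (Bd t) \<le> (2 ^ b - 1) ^ N \<and> Bd t \<subseteq> Pow (W t)" for t
        using cBd finW by (auto simp: Bd_def)
    qed (use finW cW b N T in \<open>auto simp: A_def\<close>)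
    then obtain L where L: "L \<subseteq> A" "\<And>t. t \<in> T \<Longrightarrow> L \<inter> W t \<notin> Bd t"
      unfolding avoiders_def A_def by blast
    define S where "S = {s. L \<inter> ball s q = {s}}"
    have "S \<subseteq> A" using L(1) by (auto simp: S_def)
    moreover have "finite A" using T finW by (auto simp: A_def)
    ultimately have "finite S" by (rule finite_subset)
    moreover have "separated q S"
      unfolding separated_def
    proof (intro ballI impI)
      fix s s' assume "s \<in> S" "s' \<in> S" "gd s s' \<le> q"
      then show "s = s'" by (auto simp: S_def ball_def)
    qed
    moreover have "\<exists>p\<in>P. p \<cdot> t \<in> S" if t: "t \<in> T" for t
    proof -
      obtain p where p: "p \<in> P" "L \<inter> W t \<inter> ball (p \<cdot> t) q = {p \<cdot> t}"
        using L(2)[OF t] by (auto simp: Bd_def)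
      moreover have "L \<inter> W t \<inter> ball (p \<cdot> t) q = L \<inter> ball (p \<cdot> t) q" using p(1) by (auto simp: W_def)
      ultimately show ?thesis by (auto simp: S_def)
    qed
    ultimately show "\<exists>S. finite S \<and> separated q S \<and> (\<forall>t\<in>T. \<exists>p\<in>P. p \<cdot> t \<in> S)" by blast
  qed
qed

end

section \<open>Strongly irreducible systems\<close>

text \<open>A point \<open>z :: nat \<Rightarrow> real\<close> encodes a configuration that assigns to the group element \<open>h\<close> the
  sequence of symbols \<open>k \<mapsto> val z k h\<close>.\<close>

definition val :: "(nat \<Rightarrow> real) \<Rightarrow> nat \<Rightarrow> nat \<Rightarrow> real" where
  "val z k h = z (prod_encode (k, h))"

definition mk :: "(nat \<Rightarrow> nat \<Rightarrow> real) \<Rightarrow> nat \<Rightarrow> real" where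
  "mk f i = (case prod_decode i of (k, h) \<Rightarrow> f k h)"

lemma val_mk [simp]: "val (mk f) k h = f k h"
  by (simp add: val_def mk_def)

lemma val_eqI: "(\<And>k h. val z k h = val w k h) \<Longrightarrow> z = w"
  unfolding val_def by (metis ext prod_decode_inverse surj_pair)

definition symbols :: "(nat \<Rightarrow> real) set" where
  "symbols = {z. \<forall>i. z i \<in> {0, 1, 2}}"

lemma symbols_iff: "z \<in> symbols \<longleftrightarrow> (\<forall>k h. val z k h \<in> {0, 1, 2})"
  unfolding symbols_def val_def mem_Collect_eq by (metis prod_decode_inverse surj_pair)

definition pre :: "nat \<Rightarrow> (nat \<Rightarrow> real) \<Rightarrow> (nat \<Rightarrow> real) \<Rightarrow> bool" where
  "pre M z w \<longleftrightarrow> (\<forall>i<M. z i = w i)"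

lemma pre_mono: "pre M z w \<Longrightarrow> M' \<le> M \<Longrightarrow> pre M' z w"
  by (simp add: pre_def)

lemma pre_sym: "pre M z w \<Longrightarrow> pre M w z"
  by (simp add: pre_def)

lemma pre_trans: "pre M z w \<Longrightarrow> pre M w v \<Longrightarrow> pre M z v"
  by (simp add: pre_def)

lemma three_colouring_extension:
  fixes c0 :: "nat \<Rightarrow> real" and a b :: "nat \<Rightarrow> nat"
  assumes ab: "\<And>h. a (b h) = h" "\<And>h. b (a h) = h" and nofix: "\<And>h. a h \<noteq> h"
    and c0: "\<And>h. h \<in> A \<Longrightarrow> c0 h \<in> {0, 1, 2}" "\<And>h. h \<in> A \<Longrightarrow> a h \<in> A \<Longrightarrow> c0 (a h) \<noteq> c0 h"
  obtains c where "\<And>h. c h \<in> {0, 1, 2}" "\<And>h. h \<in> A \<Longrightarrow> c h = c0 h" "\<And>h. c (a h) \<noteq> c h"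
proof -
  define P where "P m c \<longleftrightarrow> (\<forall>h\<in>A \<union> {..<m}. c h \<in> {0, 1, 2}) \<and> (\<forall>h\<in>A. c h = c0 h) \<and>
    (\<forall>h\<in>A \<union> {..<m}. a h \<in> A \<union> {..<m} \<longrightarrow> c (a h) \<noteq> c h)" for m :: nat and c :: "nat \<Rightarrow> real"
  have "\<exists>f. \<forall>m. P m (f m) \<and> (\<forall>h\<in>A \<union> {..<m}. f (Suc m) h = f m h)"
  proof (rule dependent_nat_choice)
    show "\<exists>c. P 0 c" using c0 by (intro exI[of _ c0]) (auto simp: P_def)
    fix c m assume c: "P m c"
    show "\<exists>d. P (Suc m) d \<and> (\<forall>h\<in>A \<union> {..<m}. d h = c h)"
    proof (cases "m \<in> A")
      case True
      then have "A \<union> {..<Suc m} = A \<union> {..<m}" by (auto simp: less_Suc_eq)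
      with c show ?thesis unfolding P_def by auto
    next
      case False
      have "\<exists>x\<in>{0, 1, 2}. x \<noteq> c (a m) \<and> x \<noteq> c (b m)" by (rule ccontr) auto
      then obtain x where x: "x \<in> {0, 1, 2}" "x \<noteq> c (a m)" "x \<noteq> c (b m)" by blast
      have am: "a h = m \<longleftrightarrow> h = b m" for h using ab by metis
      have S: "A \<union> {..<Suc m} = insert m (A \<union> {..<m})" by auto
      have "P (Suc m) (c(m := x))"
        using c x False nofix[of m] unfolding P_def S by (auto simp: am)
      with False show ?thesis by (intro exI[of _ "c(m := x)"]) auto
    qed
  qed
  then obtain f where f: "\<And>m. P m (f m)" "\<And>m h. h \<in> A \<union> {..<m} \<Longrightarrow> f (Suc m) h = f m h" by blast
  have const: "f m h = f n h" if "h \<in> A \<union> {..<n}" "n \<le> m" for m n h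
    using that(2,1) by (induction rule: dec_induct) (auto simp: f(2))
  define c where "c h = f (Suc h) h" for h
  have c: "c h = f m h" if "h < m" for h m using const[of h "Suc h" m] that by (simp add: c_def)
  show ?thesis
  proof (rule that)
    fix h
    show "c h \<in> {0, 1, 2}" using f(1)[of "Suc h"] by (auto simp: P_def c_def)
    show "c h = c0 h" if "h \<in> A" using f(1)[of "Suc h"] that by (auto simp: P_def c_def)
    show "c (a h) \<noteq> c h"
      using f(1)[of "Suc (h + a h)"] c[of h "Suc (h + a h)"] c[of "a h" "Suc (h + a h)"]
      by (auto simp: P_def)
  qed
qed

context nat_group
begin

definition act :: "nat \<Rightarrow> (nat \<Rightarrow> real) \<Rightarrow> nat \<Rightarrow> real" where
  "act g z = mk (\<lambda>k h. val z k (h \<cdot> g))"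

lemma val_act [simp]: "val (act g z) k h = val z k (h \<cdot> g)"
  by (simp add: act_def)

lemma act_e [simp]: "act e z = z"
  by (rule val_eqI) simp

lemma act_act [simp]: "act g (act h z) = act (g \<cdot> h) z"
  by (rule val_eqI) simp

lemma act_symbols: "z \<in> symbols \<Longrightarrow> act g z \<in> symbols"
  by (simp add: symbols_iff)

lemma act_pre_uniform:
  assumes "finite T" obtains M' where "\<And>z w t. t \<in> T \<Longrightarrow> pre M' z w \<Longrightarrow> pre M (act t z) (act t w)"
proof -
  define src where "src t i = (case prod_decode i of (k, h) \<Rightarrow> prod_encode (k, h \<cdot> t))" for t i
  have src: "act t z i = z (src t i)" for t z i
    by (simp add: act_def mk_def src_def val_def split: prod.split)
  define M' where "M' = Suc (\<Sum>t\<in>T. \<Sum>i<M. src t i)"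
  have "src t i < M'" if "t \<in> T" "i < M" for t i
  proof -
    have "src t i \<le> (\<Sum>i<M. src t i)" using that by (intro member_le_sum) auto
    also have "\<dots> \<le> (\<Sum>t\<in>T. \<Sum>i<M. src t i)" using that assms by (intro member_le_sum) auto
    finally show ?thesis by (simp add: M'_def)
  qed
  then show ?thesis using that[of M'] by (simp add: pre_def src)
qed

definition agree :: "nat \<Rightarrow> nat \<Rightarrow> (nat \<Rightarrow> real) \<Rightarrow> (nat \<Rightarrow> real) \<Rightarrow> bool" where
  "agree r n z w \<longleftrightarrow> (\<forall>k<n. \<forall>h. len h \<le> r \<longrightarrow> val z k h = val w k h)"

lemma agree_imp_pre: obtains r where "\<And>n z w. M \<le> n \<Longrightarrow> agree r n z w \<Longrightarrow> pre M z w"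
proof -
  define r where "r = (\<Sum>i<M. len (snd (prod_decode i)))"
  have "pre M z w" if n: "M \<le> n" "agree r n z w" for z w n
    unfolding pre_def
  proof (intro allI impI)
    fix i assume i: "i < M"
    obtain k h where kh: "prod_decode i = (k, h)" by fastforce
    then have ikh: "i = prod_encode (k, h)" by (metis prod_decode_inverse)
    have "len (snd (prod_decode i)) \<le> r" unfolding r_def using i by (intro member_le_sum) auto
    moreover have "k < n" using le_prod_encode_1[of k h] i n ikh by simp
    ultimately show "z i = w i" using n kh by (simp add: agree_def ikh val_def)
  qed
  then show ?thesis using that by blast
qed

text \<open>\<open>\<zeta> h\<close> is the point that is to be copied at the position \<open>h\<close>.\<close>

definition pasting :: "nat \<Rightarrow> nat \<Rightarrow> (nat \<Rightarrow> real) set \<Rightarrow> bool" where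
  "pasting n \<rho> Z \<longleftrightarrow>
     (\<forall>A \<zeta>. \<zeta> ` A \<subseteq> Z \<and> (\<forall>h\<in>A. \<forall>h'\<in>A. gd h h' \<le> \<rho> \<longrightarrow> \<zeta> h = \<zeta> h') \<longrightarrow>
        (\<exists>z\<in>Z. \<forall>h\<in>A. \<forall>k<n. val z k h = val (\<zeta> h) k h))"

definition irreducible :: "nat \<Rightarrow> nat \<Rightarrow> (nat \<Rightarrow> real) set \<Rightarrow> bool" where
  "irreducible n \<rho> Z \<longleftrightarrow> Z \<subseteq> symbols \<and> (\<forall>z\<in>Z. \<forall>g. act g z \<in> Z) \<and>
     (\<forall>z\<in>Z. \<forall>w\<in>symbols. (\<forall>k<n. \<forall>h. val w k h = val z k h) \<longrightarrow> w \<in> Z) \<and> pasting n \<rho> Z"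

lemma irreducibleI:
  assumes "Z \<subseteq> symbols" "\<And>z g. z \<in> Z \<Longrightarrow> act g z \<in> Z"
    "\<And>z w. z \<in> Z \<Longrightarrow> w \<in> symbols \<Longrightarrow> (\<And>k h. k < n \<Longrightarrow> val w k h = val z k h) \<Longrightarrow> w \<in> Z"
    "\<And>A \<zeta>. (\<And>h. h \<in> A \<Longrightarrow> \<zeta> h \<in> Z) \<Longrightarrow>
       (\<And>h h'. h \<in> A \<Longrightarrow> h' \<in> A \<Longrightarrow> gd h h' \<le> \<rho> \<Longrightarrow> \<zeta> h = \<zeta> h') \<Longrightarrow>
       \<exists>z\<in>Z. \<forall>h\<in>A. \<forall>k<n. val z k h = val (\<zeta> h) k h"
  shows "irreducible n \<rho> Z"
proof -
  have "pasting n \<rho> Z"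
    unfolding pasting_def
  proof (intro allI impI, elim conjE)
    fix A \<zeta> assume A: "\<zeta> ` A \<subseteq> Z" "\<forall>h\<in>A. \<forall>h'\<in>A. gd h h' \<le> \<rho> \<longrightarrow> \<zeta> h = \<zeta> h'"
    show "\<exists>z\<in>Z. \<forall>h\<in>A. \<forall>k<n. val z k h = val (\<zeta> h) k h"
    proof (rule assms(4))
      show "\<zeta> h = \<zeta> h'" if "h \<in> A" "h' \<in> A" "gd h h' \<le> \<rho>" for h h'
        using A(2) that by blast
    qed (use A(1) in auto)
  qed
  then show ?thesis using assms(1-3) by (simp add: irreducible_def)
qed

lemma irreducible_symbols: "irreducible n \<rho> Z \<Longrightarrow> Z \<subseteq> symbols"
  by (simp add: irreducible_def)

lemma irreducible_act: "irreducible n \<rho> Z \<Longrightarrow> z \<in> Z \<Longrightarrow> act g z \<in> Z"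
  by (simp add: irreducible_def)

lemma irreducible_level:
  "irreducible n \<rho> Z \<Longrightarrow> z \<in> Z \<Longrightarrow> w \<in> symbols \<Longrightarrow> (\<And>k h. k < n \<Longrightarrow> val w k h = val z k h) \<Longrightarrow> w \<in> Z"
  by (simp add: irreducible_def)

lemma irreducible_paste:
  assumes "irreducible n \<rho> Z" "\<And>h. h \<in> A \<Longrightarrow> \<zeta> h \<in> Z"
    "\<And>h h'. h \<in> A \<Longrightarrow> h' \<in> A \<Longrightarrow> gd h h' \<le> \<rho> \<Longrightarrow> \<zeta> h = \<zeta> h'"
  obtains z where "z \<in> Z" "\<And>h k. h \<in> A \<Longrightarrow> k < n \<Longrightarrow> val z k h = val (\<zeta> h) k h"
proof -
  have "\<zeta> ` A \<subseteq> Z \<and> (\<forall>h\<in>A. \<forall>h'\<in>A. gd h h' \<le> \<rho> \<longrightarrow> \<zeta> h = \<zeta> h')"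
    using assms(2,3) by blast
  moreover have "pasting n \<rho> Z" using assms(1) by (simp add: irreducible_def)
  ultimately have "\<exists>z\<in>Z. \<forall>h\<in>A. \<forall>k<n. val z k h = val (\<zeta> h) k h"
    unfolding pasting_def by (elim allE impE)
  then show ?thesis using that by blast
qed

lemma irreducible_paste_rel:
  assumes Z: "irreducible n \<rho> Z" and src: "\<And>h y. src h y \<Longrightarrow> y \<in> Z"
    "\<And>h h' y y'. src h y \<Longrightarrow> src h' y' \<Longrightarrow> gd h h' \<le> \<rho> \<Longrightarrow> y = y'"
  obtains z where "z \<in> Z" "\<And>h y k. src h y \<Longrightarrow> k < n \<Longrightarrow> val z k h = val y k h"
proof -
  have the: "(THE y. src h y) = y" if "src h y" for h y
    using that src(2)[of h _ h] by (intro the_equality) auto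
  obtain z where z: "z \<in> Z"
    "\<And>h k. h \<in> {h. \<exists>y. src h y} \<Longrightarrow> k < n \<Longrightarrow> val z k h = val (THE y. src h y) k h"
  proof (rule irreducible_paste[OF Z, of "{h. \<exists>y. src h y}" "\<lambda>h. THE y. src h y"])
    show "(THE y. src h y) \<in> Z" if "h \<in> {h. \<exists>y. src h y}" for h
      using that src(1) the by auto
    show "(THE y. src h y) = (THE y. src h' y)"
      if "h \<in> {h. \<exists>y. src h y}" "h' \<in> {h. \<exists>y. src h y}" "gd h h' \<le> \<rho>" for h h'
      using that src(2) the by auto
  qed blast
  show ?thesis
  proof (rule that[OF z(1)])
    show "val z k h = val y k h" if "src h y" "k < n" for h y k
      using z(2)[of h k] the[OF that(1)] that by auto
  qed
qed

lemma irreducible_nonempty: "irreducible n \<rho> Z \<Longrightarrow> Z \<noteq> {}"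
  by (rule irreducible_paste[of n \<rho> Z "{}"]) auto

lemma irreducible_all: "irreducible 0 0 symbols"
proof -
  have "(\<lambda>_. 0) \<in> symbols" by (simp add: symbols_def)
  then have "pasting 0 0 symbols" unfolding pasting_def by blast
  then show ?thesis by (simp add: irreducible_def act_symbols)
qed

lemma irreducible_raise:
  assumes Z: "irreducible n \<rho> Z" and nn: "n \<le> n'"
  shows "irreducible n' \<rho> Z"
proof (rule irreducibleI)
  fix A \<zeta> assume A: "\<And>h. h \<in> A \<Longrightarrow> \<zeta> h \<in> Z" "\<And>h h'. h \<in> A \<Longrightarrow> h' \<in> A \<Longrightarrow> gd h h' \<le> \<rho> \<Longrightarrow> \<zeta> h = \<zeta> h'"
  obtain z where z: "z \<in> Z" "\<And>h k. h \<in> A \<Longrightarrow> k < n \<Longrightarrow> val z k h = val (\<zeta> h) k h"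
    by (rule irreducible_paste[OF Z, of A \<zeta>]) (use A in \<open>blast+\<close>)
  define w where "w = mk (\<lambda>k h. if k \<ge> n \<and> h \<in> A then val (\<zeta> h) k h else val z k h)"
  have "w \<in> symbols"
    using z(1) A(1) irreducible_symbols[OF Z] by (auto simp: w_def symbols_iff subset_iff)
  then have "w \<in> Z" by (rule irreducible_level[OF Z z(1)]) (simp add: w_def)
  moreover have "val w k h = val (\<zeta> h) k h" if "h \<in> A" for k h
    using that z(2) by (simp add: w_def)
  ultimately show "\<exists>z\<in>Z. \<forall>h\<in>A. \<forall>k<n'. val z k h = val (\<zeta> h) k h" by blast
next
  fix z w assume "z \<in> Z" "w \<in> symbols" "\<And>k h. k < n' \<Longrightarrow> val w k h = val z k h"
  then show "w \<in> Z" using nn by (intro irreducible_level[OF Z, of z w]) auto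
qed (use irreducible_symbols[OF Z] irreducible_act[OF Z] in auto)

lemma irreducible_free:
  assumes Z: "irreducible n \<rho> Z" and g: "g \<noteq> e"
  shows "\<exists>\<rho>'. irreducible (Suc n) \<rho>' {z\<in>Z. \<forall>h. val z n (g \<cdot> h) \<noteq> val z n h}"
proof (intro exI[of _ "max \<rho> (len g)"] irreducibleI)
  let ?Z = "{z\<in>Z. \<forall>h. val z n (g \<cdot> h) \<noteq> val z n h}"
  fix A \<zeta> assume A: "\<And>h. h \<in> A \<Longrightarrow> \<zeta> h \<in> ?Z"
    "\<And>h h'. h \<in> A \<Longrightarrow> h' \<in> A \<Longrightarrow> gd h h' \<le> max \<rho> (len g) \<Longrightarrow> \<zeta> h = \<zeta> h'"
  obtain z where z: "z \<in> Z" "\<And>h k. h \<in> A \<Longrightarrow> k < n \<Longrightarrow> val z k h = val (\<zeta> h) k h"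
  proof (rule irreducible_paste[OF Z, of A \<zeta>])
    show "\<zeta> h = \<zeta> h'" if "h \<in> A" "h' \<in> A" "gd h h' \<le> \<rho>" for h h'
      using A(2)[OF that(1,2)] that(3) by simp
  qed (use A(1) in blast)+
  have gh: "g \<cdot> h \<noteq> h" for h using g right_cancel[of g h e] by simp
  have range: "val (\<zeta> h) n h \<in> {0, 1, 2}" if "h \<in> A" for h
    using A(1)[OF that] irreducible_symbols[OF Z] by (auto simp: symbols_iff subset_iff)
  have proper: "val (\<zeta> (g \<cdot> h)) n (g \<cdot> h) \<noteq> val (\<zeta> h) n h" if "h \<in> A" "g \<cdot> h \<in> A" for h
    using A(1)[OF that(1)] A(2)[OF that(2,1)] by simp
  obtain c where c: "\<And>h. c h \<in> {0, 1, 2}" "\<And>h. h \<in> A \<Longrightarrow> c h = val (\<zeta> h) n h" "\<And>h. c (g \<cdot> h) \<noteq> c h"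
    using three_colouring_extension[of "\<lambda>h. g \<cdot> h" "\<lambda>h. iv g \<cdot> h" A "\<lambda>h. val (\<zeta> h) n h",
        OF cancel_inv(2,1) gh range proper] by blast
  define w where "w = mk (\<lambda>k h. if k = n then c h else val z k h)"
  have "w \<in> symbols"
    using z(1) c(1) irreducible_symbols[OF Z] by (auto simp: w_def symbols_iff subset_iff)
  then have "w \<in> Z" by (rule irreducible_level[OF Z z(1)]) (simp add: w_def)
  then have "w \<in> ?Z" using c(3) by (simp add: w_def)
  moreover have "val w k h = val (\<zeta> h) k h" if "h \<in> A" "k < Suc n" for k h
    using that z(2) c(2) by (simp add: w_def)
  ultimately show "\<exists>z\<in>?Z. \<forall>h\<in>A. \<forall>k<Suc n. val z k h = val (\<zeta> h) k h" by blast
next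
  fix z w assume zw: "z \<in> {z\<in>Z. \<forall>h. val z n (g \<cdot> h) \<noteq> val z n h}" "w \<in> symbols"
    "\<And>k h. k < Suc n \<Longrightarrow> val w k h = val z k h"
  then have "w \<in> Z" by (intro irreducible_level[OF Z, of z w]) auto
  with zw show "w \<in> {z\<in>Z. \<forall>h. val z n (g \<cdot> h) \<noteq> val z n h}" by simp
qed (use irreducible_symbols[OF Z] irreducible_act[OF Z] in auto)

lemma exists_occurrences:
  assumes Z: "irreducible n \<rho> Z" and w: "w \<in> Z" and S: "separated (\<rho> + 2 * r) S"
  shows "\<exists>z\<in>Z. \<forall>s\<in>S. agree r n (act s z) w"
proof -
  define src where "src h y \<longleftrightarrow> (\<exists>s\<in>S. gd h s \<le> r \<and> y = act (iv s) w)" for h y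
  obtain z where z: "z \<in> Z" "\<And>h y k. src h y \<Longrightarrow> k < n \<Longrightarrow> val z k h = val y k h"
  proof (rule irreducible_paste_rel[OF Z, of src])
    show "y \<in> Z" if "src h y" for h y using that w irreducible_act[OF Z] by (auto simp: src_def)
    fix h h' y y' assume "src h y" "src h' y'" and d: "gd h h' \<le> \<rho>"
    then obtain s s' where s: "s \<in> S" "gd h s \<le> r" "y = act (iv s) w" "s' \<in> S" "gd h' s' \<le> r"
      "y' = act (iv s') w" by (auto simp: src_def)
    have "gd s s' \<le> \<rho> + 2 * r"
      using gd_triangle[of s s' h] gd_triangle[of h s' h'] gd_commute[of s h] s d by simp
    then have "s = s'" using separatedD[OF S] s by blast
    with s show "y = y'" by simp
  qed blast
  have "agree r n (act s z) w" if s: "s \<in> S" for s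
    unfolding agree_def
  proof (intro allI impI)
    fix k h assume "k < n" "len h \<le> r"
    then show "val (act s z) k h = val w k h"
      using z(2)[of "h \<cdot> s" "act (iv s) w" k] s by (force simp: src_def)
  qed
  with z(1) show ?thesis by blast
qed

definition marks :: "nat \<Rightarrow> nat \<Rightarrow> nat \<Rightarrow> (nat \<Rightarrow> real) \<Rightarrow> nat set \<Rightarrow> (nat \<Rightarrow> real) \<Rightarrow> bool" where
  "marks d \<kappa> n u C z \<longleftrightarrow> separated d C \<and> (\<forall>g. \<exists>c\<in>C. gd g c \<le> d) \<and> (\<forall>c\<in>C. agree \<kappa> n (act c z) u)"

lemma maximal_separated:
  assumes "separated d C0"
  obtains C where "C0 \<subseteq> C" "separated d C" "\<And>g. \<exists>c\<in>C. gd g c \<le> d"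
proof -
  define \<A> where "\<A> = {C. C0 \<subseteq> C \<and> separated d C}"
  have "\<exists>C\<in>\<A>. \<forall>D\<in>\<A>. C \<subseteq> D \<longrightarrow> D = C"
  proof (rule subset_Zorn_nonempty)
    show "\<A> \<noteq> {}" using assms by (auto simp: \<A>_def)
    fix \<C> assume C: "\<C> \<noteq> {}" "subset.chain \<A> \<C>"
    then have "separated d (\<Union>\<C>)"
      unfolding separated_def \<A>_def subset_chain_def by (smt (verit) UnionE mem_Collect_eq subset_eq)
    moreover have "C0 \<subseteq> \<Union>\<C>" using C by (fastforce simp: \<A>_def subset_chain_def)
    ultimately show "\<Union>\<C> \<in> \<A>" by (simp add: \<A>_def)
  qed
  then obtain C where C: "C0 \<subseteq> C" "separated d C" "\<And>D. D \<in> \<A> \<Longrightarrow> C \<subseteq> D \<Longrightarrow> D = C"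
    by (auto simp: \<A>_def)
  have "\<exists>c\<in>C. gd g c \<le> d" for g
  proof (rule ccontr)
    assume far: "\<not> (\<exists>c\<in>C. gd g c \<le> d)"
    then have "separated d (insert g C)"
      using C(2) gd_commute[of g] by (auto simp: separated_def)
    then have "insert g C = C" using C by (intro C(3)) (auto simp: \<A>_def)
    with far show False by (metis gd_refl insertI1 zero_le)
  qed
  with C that show ?thesis by blast
qed

text \<open>When points are pasted, their markers near the positions to be copied are kept and completed to a
  maximal separated set. A new marker is far from everything that is kept: the marker set of the old
  point was already maximal, so a new marker near its position would be close to a kept one.\<close>

lemma irreducible_marked:
  assumes Z: "irreducible n \<rho> Z" and u: "u \<in> Z" and d: "d \<ge> 2 * \<kappa> + \<rho>"
  shows "\<exists>\<rho>'. irreducible n \<rho>' {z\<in>Z. \<exists>C. marks d \<kappa> n u C z}"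
proof -
  define l where "l = d + \<kappa> + \<rho>"
  let ?Z = "{z\<in>Z. \<exists>C. marks d \<kappa> n u C z}"
  have "irreducible n (2 * (\<kappa> + l) + \<rho> + d) ?Z"
  proof (rule irreducibleI)
    fix A \<zeta> assume A: "\<And>h. h \<in> A \<Longrightarrow> \<zeta> h \<in> ?Z"
      "\<And>h h'. h \<in> A \<Longrightarrow> h' \<in> A \<Longrightarrow> gd h h' \<le> 2 * (\<kappa> + l) + \<rho> + d \<Longrightarrow> \<zeta> h = \<zeta> h'"
    define Cf where "Cf y = (SOME C. marks d \<kappa> n u C y)" for y
    have Cf: "marks d \<kappa> n u (Cf (\<zeta> h)) (\<zeta> h)" if "h \<in> A" for h
      unfolding Cf_def using A(1)[OF that] by (auto intro: someI_ex)
    define C0 where "C0 = {c. \<exists>a\<in>A. c \<in> Cf (\<zeta> a) \<and> gd c a \<le> l}"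
    have "separated d C0"
      unfolding separated_def
    proof (intro ballI impI)
      fix c c' assume "c \<in> C0" "c' \<in> C0" and cc: "gd c c' \<le> d"
      then obtain a a' where a: "a \<in> A" "c \<in> Cf (\<zeta> a)" "gd c a \<le> l"
        "a' \<in> A" "c' \<in> Cf (\<zeta> a')" "gd c' a' \<le> l" by (auto simp: C0_def)
      have "gd a a' \<le> 2 * (\<kappa> + l) + \<rho> + d"
        using gd_triangle[of a a' c] gd_triangle[of c a' c'] gd_commute[of a c] a cc by simp
      then have "\<zeta> a = \<zeta> a'" using A(2) a by blast
      then show "c = c'" using Cf[OF a(1)] a cc by (auto simp: marks_def dest: separatedD)
    qed
    then obtain C where C: "C0 \<subseteq> C" "separated d C" "\<And>g. \<exists>c\<in>C. gd g c \<le> d"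
      by (rule maximal_separated) blast
    define old where "old h y \<longleftrightarrow> (\<exists>a\<in>A. y = \<zeta> a \<and> (h = a \<or> (\<exists>c\<in>Cf (\<zeta> a). gd c a \<le> l \<and> gd h c \<le> \<kappa>)))"
      for h y
    define new where "new h y \<longleftrightarrow> (\<exists>c\<in>C - C0. gd h c \<le> \<kappa> \<and> y = act (iv c) u)" for h y
    have old_old: "y = y'" if "old h y" "old h' y'" "gd h h' \<le> \<rho>" for h h' y y'
    proof -
      have near: "\<exists>a\<in>A. y = \<zeta> a \<and> gd h a \<le> \<kappa> + l" if hy: "old h y" for h y
      proof -
        obtain a where a: "a \<in> A" "y = \<zeta> a" "h = a \<or> (\<exists>c\<in>Cf (\<zeta> a). gd c a \<le> l \<and> gd h c \<le> \<kappa>)"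
          using hy by (auto simp: old_def)
        have "gd h a \<le> \<kappa> + l" using a(3)
        proof (elim disjE bexE)
          show "gd h a \<le> \<kappa> + l" if "gd c a \<le> l \<and> gd h c \<le> \<kappa>" for c
            using gd_triangle[of h a c] that by simp
        qed simp
        with a show ?thesis by blast
      qed
      obtain a where a: "a \<in> A" "y = \<zeta> a" "gd h a \<le> \<kappa> + l"
        using near[OF \<open>old h y\<close>] by blast
      obtain a' where a': "a' \<in> A" "y' = \<zeta> a'" "gd h' a' \<le> \<kappa> + l"
        using near[OF \<open>old h' y'\<close>] by blast
      have "gd a a' \<le> 2 * (\<kappa> + l) + \<rho> + d"
        using gd_triangle[of a a' h] gd_triangle[of h a' h'] gd_commute[of a h] a a' \<open>gd h h' \<le> \<rho>\<close>
        by simp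
      with a a' A(2) show ?thesis by blast
    qed
    have new_new: "y = y'" if hyps: "new h y" "new h' y'" "gd h h' \<le> \<rho>" for h h' y y'
    proof -
      obtain c c' where c: "c \<in> C" "gd h c \<le> \<kappa>" "y = act (iv c) u" "c' \<in> C" "gd h' c' \<le> \<kappa>"
        "y' = act (iv c') u" using hyps by (auto simp: new_def)
      have "gd c c' \<le> d"
        using gd_triangle[of c c' h] gd_triangle[of h c' h'] gd_commute[of c h] c d hyps(3) by simp
      then have "c = c'" using separatedD[OF C(2)] c by blast
      with c show ?thesis by simp
    qed
    have old_new: False if hyps: "old h y" "new h' y'" "gd h h' \<le> \<rho>" for h h' y y'
    proof -
      obtain c' where c': "c' \<in> C" "c' \<notin> C0" "gd h' c' \<le> \<kappa>" using hyps by (auto simp: new_def)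
      have hc': "gd h c' \<le> \<rho> + \<kappa>" using gd_triangle[of h c' h'] c' hyps(3) by simp
      obtain a where a: "a \<in> A" "h = a \<or> (\<exists>c\<in>Cf (\<zeta> a). gd c a \<le> l \<and> gd h c \<le> \<kappa>)"
        using hyps by (auto simp: old_def)
      have "\<exists>c\<in>C0. gd c c' \<le> d" using a(2)
      proof (elim disjE bexE)
        assume "h = a"
        obtain c where c: "c \<in> Cf (\<zeta> a)" "gd c' c \<le> d" using Cf[OF a(1)] by (auto simp: marks_def)
        have "gd c a \<le> l"
          using gd_triangle[of c a c'] gd_commute[of c c'] gd_commute[of a c'] hc' c \<open>h = a\<close>
          by (simp add: l_def)
        with c a gd_commute[of c c'] show ?thesis by (auto simp: C0_def)
      next
        fix c assume c: "c \<in> Cf (\<zeta> a)" "gd c a \<le> l \<and> gd h c \<le> \<kappa>"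
        then have "gd c c' \<le> d" using gd_triangle[of c c' h] gd_commute[of c h] hc' d by simp
        with c a show ?thesis by (auto simp: C0_def)
      qed
      with C c' separatedD[OF C(2)] show False by blast
    qed
    obtain z where z: "z \<in> Z" "\<And>h y k. old h y \<or> new h y \<Longrightarrow> k < n \<Longrightarrow> val z k h = val y k h"
    proof (rule irreducible_paste_rel[OF Z, of "\<lambda>h y. old h y \<or> new h y"])
      show "y \<in> Z" if "old h y \<or> new h y" for h y
        using that A(1) u irreducible_act[OF Z] by (auto simp: old_def new_def)
      show "y = y'" if "old h y \<or> new h y" "old h' y' \<or> new h' y'" "gd h h' \<le> \<rho>" for h h' y y'
        using that old_old new_new old_new gd_commute[of h h'] by metis
    qed blast
    have "agree \<kappa> n (act c z) u" if c: "c \<in> C" for c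
      unfolding agree_def
    proof (intro allI impI)
      fix k h assume kh: "k < n" "len h \<le> \<kappa>"
      show "val (act c z) k h = val u k h"
      proof (cases "c \<in> C0")
        case True
        then obtain a where a: "a \<in> A" "c \<in> Cf (\<zeta> a)" "gd c a \<le> l" by (auto simp: C0_def)
        then have "old (h \<cdot> c) (\<zeta> a)" using kh by (force simp: old_def)
        then have "val z k (h \<cdot> c) = val (act c (\<zeta> a)) k h" using z(2) kh by simp
        also have "\<dots> = val u k h" using Cf[OF a(1)] a kh by (simp add: marks_def agree_def)
        finally show ?thesis by simp
      next
        case False
        then have "new (h \<cdot> c) (act (iv c) u)" using c kh by (force simp: new_def)
        then show ?thesis using z(2)[of "h \<cdot> c" "act (iv c) u" k] kh by simp
      qed
    qed
    then have "z \<in> ?Z" using z(1) C by (auto simp: marks_def)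
    moreover have "val z k h = val (\<zeta> h) k h" if "h \<in> A" "k < n" for k h
      using that z(2) by (auto simp: old_def)
    ultimately show "\<exists>z\<in>?Z. \<forall>h\<in>A. \<forall>k<n. val z k h = val (\<zeta> h) k h" by blast
  next
    fix z g assume "z \<in> ?Z"
    then obtain C where C: "z \<in> Z" "marks d \<kappa> n u C z" by blast
    have "marks d \<kappa> n u ((\<lambda>c. c \<cdot> iv g) ` C) (act g z)"
      unfolding marks_def
    proof (intro conjI allI ballI)
      show "separated d ((\<lambda>c. c \<cdot> iv g) ` C)" using C(2) by (auto simp: marks_def separated_def)
      fix h
      obtain c where "c \<in> C" "gd (h \<cdot> g) c \<le> d" using C(2) by (auto simp: marks_def)
      then show "\<exists>c\<in>(\<lambda>c. c \<cdot> iv g) ` C. gd h c \<le> d"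
        using gd_right[of "h \<cdot> g" "iv g" c] by (intro bexI[of _ "c \<cdot> iv g"]) auto
    next
      fix c assume "c \<in> (\<lambda>c. c \<cdot> iv g) ` C"
      then show "agree \<kappa> n (act c (act g z)) u" using C(2) by (auto simp: marks_def)
    qed
    then show "act g z \<in> ?Z" using C irreducible_act[OF Z] by blast
  next
    fix z w assume zw: "z \<in> ?Z" "w \<in> symbols" "\<And>k h. k < n \<Longrightarrow> val w k h = val z k h"
    then have "w \<in> Z" by (intro irreducible_level[OF Z, of z w]) auto
    moreover have "marks d \<kappa> n u C w" if "marks d \<kappa> n u C z" for C
      using that zw(3) by (auto simp: marks_def agree_def)
    ultimately show "w \<in> ?Z" using zw(1) by blast
  qed (use irreducible_symbols[OF Z] in auto)
  then show ?thesis by blast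
qed

text \<open>\<open>R\<close> stands for the set of times at which all the other systems make the required visit.\<close>

definition hits :: "nat \<Rightarrow> (nat \<Rightarrow> real) \<Rightarrow> (nat \<Rightarrow> real) set \<Rightarrow> nat set \<Rightarrow> nat set \<Rightarrow> nat set \<Rightarrow> bool" where
  "hits M w Z P T T' \<longleftrightarrow> (\<forall>z\<in>Z. \<forall>R. (\<forall>g. \<exists>t\<in>T. \<forall>p\<in>P. p \<cdot> (t \<cdot> g) \<in> R) \<longrightarrow>
     (\<exists>t\<in>T'. t \<in> R \<and> pre M (act t z) w))"

lemma irreducible_hit:
  assumes Z: "irreducible n \<rho> Z" and w: "w \<in> Z"
  shows "\<exists>q N. \<forall>P T. finite P \<and> card P = N \<and> separated q P \<and> finite T \<longrightarrow>
    (\<exists>n' \<rho>' Z' T'. irreducible n' \<rho>' Z' \<and> Z' \<subseteq> Z \<and> finite T' \<and> hits M w Z' P T T')"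
proof -
  obtain r where r: "\<And>n z w. M \<le> n \<Longrightarrow> agree r n z w \<Longrightarrow> pre M z w"
    using agree_imp_pre by blast
  define m where "m = max n M"
  have Zm: "irreducible m \<rho> Z" using irreducible_raise[OF Z] by (simp add: m_def)
  define q where "q = \<rho> + 2 * r"
  obtain N where N: "\<And>P T. card P = N \<Longrightarrow> finite P \<Longrightarrow> separated (2 * q) P \<Longrightarrow> finite T \<Longrightarrow>
     \<exists>S. finite S \<and> separated q S \<and> (\<forall>t\<in>T. \<exists>p\<in>P. p \<cdot> t \<in> S)"
    using exists_hitting_set[of q] by blast
  show ?thesis
  proof (rule exI[of _ "2 * q"], rule exI[of _ N], intro allI impI)
    fix P T :: "nat set" assume PT: "finite P \<and> card P = N \<and> separated (2 * q) P \<and> finite T"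
    then have "\<exists>S. finite S \<and> separated q S \<and> (\<forall>t\<in>T. \<exists>p\<in>P. p \<cdot> t \<in> S)" using N[of P T] by simp
    then obtain S where S: "finite S" "separated q S" "\<And>t. t \<in> T \<Longrightarrow> \<exists>p\<in>P. p \<cdot> t \<in> S" by blast
    obtain u where u: "u \<in> Z" "\<And>s. s \<in> S \<Longrightarrow> agree r m (act s u) w"
      using exists_occurrences[OF Zm w S(2)[unfolded q_def]] by (elim bexE) auto
    define \<kappa> where "\<kappa> = (\<Sum>s\<in>S. len s) + r"
    have \<kappa>: "len s + r \<le> \<kappa>" if "s \<in> S" for s
      using member_le_sum[of s S len] that S(1) by (simp add: \<kappa>_def)
    define d where "d = 2 * \<kappa> + \<rho>"
    define Z' where "Z' = {z\<in>Z. \<exists>C. marks d \<kappa> m u C z}"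
    define T' where "T' = (\<lambda>(s, c). s \<cdot> c) ` (S \<times> {c. len c \<le> d})"
    obtain \<rho>' where "irreducible m \<rho>' Z'"
      using irreducible_marked[OF Zm u(1), of \<kappa> d] by (auto simp: d_def Z'_def)
    moreover have "Z' \<subseteq> Z" by (auto simp: Z'_def)
    moreover have "finite T'" using S(1) finite_len by (simp add: T'_def)
    moreover have "\<exists>t\<in>T'. t \<in> R \<and> pre M (act t z) w"
      if z: "z \<in> Z'" and R: "\<forall>g. \<exists>t\<in>T. \<forall>p\<in>P. p \<cdot> (t \<cdot> g) \<in> R" for z R
    proof -
      obtain C where C: "marks d \<kappa> m u C z" using z by (auto simp: Z'_def)
      then obtain c where c: "c \<in> C" "gd e c \<le> d" unfolding marks_def by blast
      obtain t where t: "t \<in> T" "\<And>p. p \<in> P \<Longrightarrow> p \<cdot> (t \<cdot> c) \<in> R" using R by blast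
      obtain p where p: "p \<in> P" "p \<cdot> t \<in> S" using S(3) t(1) by blast
      define s where "s = p \<cdot> t"
      have s: "s \<in> S" "s \<cdot> c \<in> R" using p t(2)[OF p(1)] by (simp_all add: s_def)
      have "agree r m (act (s \<cdot> c) z) w"
        unfolding agree_def
      proof (intro allI impI)
        fix k h assume kh: "k < m" "len h \<le> r"
        have "len (h \<cdot> s) \<le> \<kappa>" using len_mul[of h s] \<kappa>[OF s(1)] kh by simp
        then have "val (act c z) k (h \<cdot> s) = val u k (h \<cdot> s)"
          using C c kh unfolding marks_def agree_def by blast
        moreover have "val (act s u) k h = val w k h"
          using u(2)[OF s(1)] kh unfolding agree_def by blast
        ultimately show "val (act (s \<cdot> c) z) k h = val w k h" by simp
      qed
      then have "pre M (act (s \<cdot> c) z) w" using r[of m] by (simp add: m_def)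
      moreover have "s \<cdot> c \<in> T'" using s c by (force simp: T'_def)
      ultimately show ?thesis using s by blast
    qed
    then have "hits M w Z' P T T'" unfolding hits_def by blast
    ultimately show "\<exists>n' \<rho>' Z' T'. irreducible n' \<rho>' Z' \<and> Z' \<subseteq> Z \<and> finite T' \<and> hits M w Z' P T T'"
      by blast
  qed
qed

end

section \<open>Simultaneous visits\<close>

context nat_group
begin

definition good :: "(nat \<Rightarrow> real) set \<Rightarrow> bool" where
  "good Z \<longleftrightarrow> (\<exists>n \<rho>. irreducible n \<rho> Z)"

lemma good_all: "good symbols"
  using irreducible_all by (auto simp: good_def)

lemma good_symbols: "good Z \<Longrightarrow> Z \<subseteq> symbols"
  using irreducible_symbols by (auto simp: good_def)

lemma good_nonempty: "good Z \<Longrightarrow> Z \<noteq> {}"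
  using irreducible_nonempty by (auto simp: good_def)

lemma good_act: "good Z \<Longrightarrow> z \<in> Z \<Longrightarrow> act g z \<in> Z"
  using irreducible_act by (auto simp: good_def)

definition moves :: "nat \<Rightarrow> (nat \<Rightarrow> real) set \<Rightarrow> bool" where
  "moves g Z \<longleftrightarrow> (g \<noteq> e \<longrightarrow> (\<exists>k. \<forall>z\<in>Z. val z k g \<noteq> val z k e))"

lemma moves_mono: "moves g Z \<Longrightarrow> Z' \<subseteq> Z \<Longrightarrow> moves g Z'"
  unfolding moves_def by blast

lemma good_moves:
  assumes "good Z" shows "\<exists>Z'. good Z' \<and> Z' \<subseteq> Z \<and> moves g Z'"
proof (cases "g = e")
  case False
  obtain n \<rho> where "irreducible n \<rho> Z" using assms by (auto simp: good_def)
  from irreducible_free[OF this False] obtain \<rho>' where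
    "irreducible (Suc n) \<rho>' {z\<in>Z. \<forall>h. val z n (g \<cdot> h) \<noteq> val z n h}" by blast
  moreover have "moves g {z\<in>Z. \<forall>h. val z n (g \<cdot> h) \<noteq> val z n h}"
    unfolding moves_def
  proof (intro impI exI[of _ n] ballI)
    fix z assume "z \<in> {z\<in>Z. \<forall>h. val z n (g \<cdot> h) \<noteq> val z n h}"
    then have "val z n (g \<cdot> e) \<noteq> val z n e" by blast
    then show "val z n g \<noteq> val z n e" by simp
  qed
  ultimately show ?thesis by (auto simp: good_def)
qed (use assms in \<open>auto simp: moves_def\<close>)

lemma good_occurrences:
  assumes "good Z" "w \<in> Z"
  shows "\<exists>q. \<forall>S. separated q S \<longrightarrow> (\<exists>z\<in>Z. \<forall>s\<in>S. pre M (act s z) w)"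
proof -
  obtain n \<rho> where Z: "irreducible n \<rho> Z" using assms by (auto simp: good_def)
  obtain r where r: "\<And>n z w. M \<le> n \<Longrightarrow> agree r n z w \<Longrightarrow> pre M z w"
    using agree_imp_pre by blast
  have Zm: "irreducible (max n M) \<rho> Z" using irreducible_raise[OF Z] by simp
  show ?thesis
  proof (intro exI allI impI)
    fix S assume "separated (\<rho> + 2 * r) S"
    then obtain z where "z \<in> Z" "\<forall>s\<in>S. agree r (max n M) (act s z) w"
      using exists_occurrences[OF Zm assms(2)] by blast
    then show "\<exists>z\<in>Z. \<forall>s\<in>S. pre M (act s z) w" using r[of "max n M"] by (intro bexI[of _ z]) auto
  qed
qed

lemma good_hit:
  assumes "good Z" "w \<in> Z"
  shows "\<exists>q N. \<forall>P T. finite P \<and> card P = N \<and> separated q P \<and> finite T \<longrightarrow>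
    (\<exists>Z' T'. good Z' \<and> Z' \<subseteq> Z \<and> finite T' \<and> hits M w Z' P T T')"
proof -
  obtain n \<rho> where Z: "irreducible n \<rho> Z" using assms by (auto simp: good_def)
  from irreducible_hit[OF Z assms(2), of M] show ?thesis unfolding good_def by meson
qed

end

locale nat_flow = nat_group mul e iv
  for mul :: "nat \<Rightarrow> nat \<Rightarrow> nat" (infixl "\<cdot>" 70) and e iv +
  fixes X :: "'x topology" and a :: "nat \<Rightarrow> 'x \<Rightarrow> 'x"
  assumes compact: "compact_space X"
    and nonempty: "topspace X \<noteq> {}"
    and cont: "continuous_map X X (a g)"
    and a_e: "x \<in> topspace X \<Longrightarrow> a e x = x"
    and a_mul: "x \<in> topspace X \<Longrightarrow> a (g \<cdot> h) x = a g (a h x)"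
    and dense: "x \<in> topspace X \<Longrightarrow> openin X U \<Longrightarrow> U \<noteq> {} \<Longrightarrow> \<exists>g. a g x \<in> U"
begin

lemma a_in: "x \<in> topspace X \<Longrightarrow> a g x \<in> topspace X"
  using continuous_map_image_subset_topspace[OF cont] by blast

lemma openin_pre: "openin X U \<Longrightarrow> openin X {x\<in>topspace X. a g x \<in> U}"
  using openin_continuous_map_preimage[OF cont] .

lemma finite_cover:
  assumes U: "openin X U" "U \<noteq> {}"
  shows "\<exists>T. finite T \<and> (\<forall>x\<in>topspace X. \<exists>t\<in>T. a t x \<in> U)"
proof -
  let ?V = "\<lambda>g. {x\<in>topspace X. a g x \<in> U}"
  have cov: "topspace X \<subseteq> \<Union>(range ?V)" using dense[OF _ U] by blast
  have "\<exists>\<F>. finite \<F> \<and> \<F> \<subseteq> range ?V \<and> topspace X \<subseteq> \<Union>\<F>"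
    using compact[unfolded compact_space_alt, rule_format, of "range ?V"] cov openin_pre[OF U(1)] by blast
  then obtain \<F> where "finite \<F>" "\<F> \<subseteq> range ?V" "topspace X \<subseteq> \<Union>\<F>" by blast
  moreover then obtain T where "finite T" "\<F> = ?V ` T" by (meson finite_subset_image)
  ultimately show ?thesis by (intro exI[of _ T]) auto
qed

lemma separated_return_times:
  assumes U: "openin X U" and x: "x \<in> U"
  shows "\<exists>P. finite P \<and> card P = N \<and> separated q P \<and> (\<forall>p\<in>P. a p x \<in> U)"
proof (induction N)
  case 0
  show ?case by (intro exI[of _ "{}"]) (auto simp: separated_def)
next
  case (Suc N)
  then obtain P where P: "finite P" "card P = N" "separated q P" "\<forall>p\<in>P. a p x \<in> U" by blast
  have xX: "x \<in> topspace X" using U x openin_subset by blast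
  obtain T where T: "finite T" "\<And>y. y \<in> topspace X \<Longrightarrow> \<exists>t\<in>T. a t y \<in> U"
    using finite_cover[OF U] x by blast
  have "finite (\<Union>t\<in>T. \<Union>p\<in>P. (\<lambda>h. iv t \<cdot> h) ` ball p q)"
    using T P finite_ball by blast
  then obtain g where g: "g \<notin> (\<Union>t\<in>T. \<Union>p\<in>P. (\<lambda>h. iv t \<cdot> h) ` ball p q)"
    using ex_new_if_finite[OF infinite_UNIV_nat] by blast
  obtain t where t: "t \<in> T" "a t (a g x) \<in> U" using T(2) a_in[OF xX] by blast
  have far: "\<not> gd (t \<cdot> g) p \<le> q" if "p \<in> P" for p
  proof
    assume "gd (t \<cdot> g) p \<le> q"
    then have "g \<in> (\<lambda>h. iv t \<cdot> h) ` ball p q" by (intro image_eqI[of _ _ "t \<cdot> g"]) (auto simp: ball_def)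
    with g t that show False by blast
  qed
  have "t \<cdot> g \<notin> P" using far[of "t \<cdot> g"] by auto
  moreover have "separated q (insert (t \<cdot> g) P)"
    using P(3) far gd_commute[of "t \<cdot> g"] by (auto simp: separated_def)
  ultimately show ?case
    using P t a_mul[OF xX] by (intro exI[of _ "insert (t \<cdot> g) P"]) auto
qed

definition visits :: "nat \<Rightarrow> 'i set \<Rightarrow> 'x set \<Rightarrow> ('i \<Rightarrow> nat \<Rightarrow> real) \<Rightarrow> ('i \<Rightarrow> (nat \<Rightarrow> real) set) \<Rightarrow> nat set \<Rightarrow> bool"
  where "visits M I U w Z T \<longleftrightarrow> (\<forall>x\<in>topspace X. \<forall>z. (\<forall>s\<in>I. z s \<in> Z s) \<longrightarrow>
    (\<exists>t\<in>T. a t x \<in> U \<and> (\<forall>s\<in>I. pre M (act t (z s)) (w s))))"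

lemma visits_mono:
  assumes "visits M I U w Z T" "\<And>s. s \<in> I \<Longrightarrow> Z' s \<subseteq> Z s"
  shows "visits M I U w Z' T"
  unfolding visits_def
proof (intro ballI allI impI)
  fix x z assume "x \<in> topspace X" "\<forall>s\<in>I. z s \<in> Z' s"
  moreover then have "\<forall>s\<in>I. z s \<in> Z s" using assms(2) by blast
  ultimately show "\<exists>t\<in>T. a t x \<in> U \<and> (\<forall>s\<in>I. pre M (act t (z s)) (w s))"
    using assms(1) unfolding visits_def by blast
qed

lemma visits_pre_cong:
  assumes "\<And>s. s \<in> I \<Longrightarrow> pre M (w s) (w' s)" "visits M I U w Z T"
  shows "visits M I U w' Z T"
  unfolding visits_def
proof (intro ballI allI impI)
  fix x z assume "x \<in> topspace X" "\<forall>s\<in>I. z s \<in> Z s"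
  then obtain t where "t \<in> T" "a t x \<in> U" "\<forall>s\<in>I. pre M (act t (z s)) (w s)"
    using assms(2) unfolding visits_def by blast
  then show "\<exists>t\<in>T. a t x \<in> U \<and> (\<forall>s\<in>I. pre M (act t (z s)) (w' s))"
    using assms(1) by (auto simp: pre_def)
qed

lemma exists_visits:
  assumes "finite I" "\<And>s. s \<in> I \<Longrightarrow> good (Z s)" "\<And>s. s \<in> I \<Longrightarrow> w s \<in> Z s" "openin X U" "U \<noteq> {}"
  shows "\<exists>Z' T. finite T \<and> (\<forall>s\<in>I. good (Z' s) \<and> Z' s \<subseteq> Z s) \<and> visits M I U w Z' T"
  using assms
proof (induction I arbitrary: w M U rule: finite_induct)
  case empty
  then obtain T where "finite T" "\<forall>x\<in>topspace X. \<exists>t\<in>T. a t x \<in> U" using finite_cover by blast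
  then show ?case by (auto simp: visits_def)
next
  case (insert i I)
  have i: "good (Z i)" "w i \<in> Z i" using insert.prems by auto
  obtain q0 N where hit: "\<And>P T. finite P \<and> card P = N \<and> separated q0 P \<and> finite T \<Longrightarrow>
    (\<exists>Z' T'. good Z' \<and> Z' \<subseteq> Z i \<and> finite T' \<and> hits M (w i) Z' P T T')"
    using good_hit[OF i, of M] by auto
  have "\<forall>s\<in>I. \<exists>q. \<forall>S. separated q S \<longrightarrow> (\<exists>z\<in>Z s. \<forall>p\<in>S. pre M (act p z) (w s))"
    using good_occurrences insert.prems by (metis insertI2)
  then obtain q where q: "\<And>s S. s \<in> I \<Longrightarrow> separated (q s) S \<Longrightarrow> \<exists>z\<in>Z s. \<forall>p\<in>S. pre M (act p z) (w s)"
    by metis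
  define Q where "Q = q0 + (\<Sum>s\<in>I. q s)"
  obtain x where x: "x \<in> U" using insert.prems by blast
  obtain P where P: "finite P" "card P = N" "separated Q P" "\<And>p. p \<in> P \<Longrightarrow> a p x \<in> U"
    using separated_return_times[OF insert.prems(3) x, of N Q] by blast
  have "\<exists>z\<in>Z s. \<forall>p\<in>P. pre M (act p z) (w s)" if s: "s \<in> I" for s
  proof (rule q[OF s])
    have "q s \<le> Q" using member_le_sum[of s I q] insert.hyps s by (simp add: Q_def)
    then show "separated (q s) P" using P(3) by (rule separated_mono[rotated 2]) simp
  qed
  then obtain w' where w': "\<And>s. s \<in> I \<Longrightarrow> w' s \<in> Z s" "\<And>s p. s \<in> I \<Longrightarrow> p \<in> P \<Longrightarrow> pre M (act p (w' s)) (w s)"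
    by metis
  obtain M' where M': "\<And>z w p. p \<in> P \<Longrightarrow> pre M' z w \<Longrightarrow> pre M (act p z) (act p w)"
    using act_pre_uniform[OF P(1)] by blast
  define U' where "U' = topspace X \<inter> (\<Inter>p\<in>P. {y\<in>topspace X. a p y \<in> U})"
  have "openin X U'"
    unfolding U'_def using P(1) openin_pre[OF insert.prems(3)] by (subst Int_commute) (intro openin_INT)
  moreover have "x \<in> U'" using x P(4) insert.prems(3) openin_subset by (auto simp: U'_def)
  ultimately have U': "openin X U'" "U' \<noteq> {}" by auto
  have goodI: "\<And>s. s \<in> I \<Longrightarrow> good (Z s)" using insert.prems(1) by simp
  obtain Z' T where Z': "finite T" "\<And>s. s \<in> I \<Longrightarrow> good (Z' s) \<and> Z' s \<subseteq> Z s" "visits M' I U' w' Z' T"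
  proof -
    have "\<exists>Z' T. finite T \<and> (\<forall>s\<in>I. good (Z' s) \<and> Z' s \<subseteq> Z s) \<and> visits M' I U' w' Z' T"
      by (rule insert.IH) (use goodI w'(1) U' in auto)
    then show ?thesis using that by blast
  qed
  have "separated q0 P" using P(3) by (rule separated_mono) (auto simp: Q_def)
  then obtain Zi T' where Zi: "good Zi" "Zi \<subseteq> Z i" "finite T'" "hits M (w i) Zi P T T'"
    using hit[of P T] P Z'(1) by blast
  define Z'' where "Z'' = Z'(i := Zi)"
  have "visits M (insert i I) U w Z'' T'"
    unfolding visits_def
  proof (intro ballI allI impI)
    fix y z assume y: "y \<in> topspace X" and z: "\<forall>s\<in>insert i I. z s \<in> Z'' s"
    have zI: "z s \<in> Z' s" if "s \<in> I" for s
    proof -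
      have "s \<noteq> i" using that insert.hyps by blast
      moreover have "z s \<in> Z'' s" using z that by blast
      ultimately show ?thesis by (simp add: Z''_def)
    qed
    define R where "R = {g. a g y \<in> U \<and> (\<forall>s\<in>I. pre M (act g (z s)) (w s))}"
    have "\<exists>t\<in>T. \<forall>p\<in>P. p \<cdot> (t \<cdot> g) \<in> R" for g
    proof -
      have "\<forall>s\<in>I. act g (z s) \<in> Z' s" using zI Z'(2) good_act by blast
      then obtain t where t: "t \<in> T" "a t (a g y) \<in> U'" "\<forall>s\<in>I. pre M' (act t (act g (z s))) (w' s)"
        using Z'(3)[unfolded visits_def, rule_format, OF a_in[OF y, of g], of "\<lambda>s. act g (z s)"] by blast
      have "p \<cdot> (t \<cdot> g) \<in> R" if p: "p \<in> P" for p
      proof -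
        have "a (p \<cdot> (t \<cdot> g)) y \<in> U" using t(2) p y a_in by (auto simp: U'_def a_mul)
        moreover have "pre M (act (p \<cdot> (t \<cdot> g)) (z s)) (w s)" if s: "s \<in> I" for s
        proof -
          have "pre M (act p (act t (act g (z s)))) (w s)"
            using t(3) s by (intro pre_trans[OF M'[OF p] w'(2)[OF s p]]) blast
          then show ?thesis by simp
        qed
        ultimately show ?thesis by (simp add: R_def)
      qed
      with t(1) show ?thesis by blast
    qed
    moreover have "z i \<in> Zi" using z by (simp add: Z''_def)
    ultimately obtain t where "t \<in> T'" "t \<in> R" "pre M (act t (z i)) (w i)"
      using Zi(4) unfolding hits_def by blast
    then show "\<exists>t\<in>T'. a t y \<in> U \<and> (\<forall>s\<in>insert i I. pre M (act t (z s)) (w s))"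
      by (auto simp: R_def)
  qed
  moreover have "\<forall>s\<in>insert i I. good (Z'' s) \<and> Z'' s \<subseteq> Z s"
    using Z'(2) Zi by (auto simp: Z''_def)
  ultimately show ?case using Zi(3) by blast
qed

lemma exists_visits_all:
  assumes "finite \<T>" "finite I" "\<And>s. s \<in> I \<Longrightarrow> good (Z s)"
    "\<And>U w. (U, w) \<in> \<T> \<Longrightarrow> openin X U \<and> U \<noteq> {}"
  shows "\<exists>Z'. (\<forall>s\<in>I. good (Z' s) \<and> Z' s \<subseteq> Z s) \<and>
    (\<forall>(U, w)\<in>\<T>. (\<forall>s\<in>I. \<exists>v\<in>Z' s. pre M v (w s)) \<longrightarrow> (\<exists>T. finite T \<and> visits M I U w Z' T))"
  using assms(1,4)
proof (induction \<T> rule: finite_induct)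
  case empty
  then show ?case using assms(3) by (intro exI[of _ Z]) auto
next
  case (insert \<tau> \<T>)
  obtain U w where \<tau>: "\<tau> = (U, w)" by fastforce
  obtain Z' where Z': "\<And>s. s \<in> I \<Longrightarrow> good (Z' s)" "\<And>s. s \<in> I \<Longrightarrow> Z' s \<subseteq> Z s"
    "\<And>U w. (U, w) \<in> \<T> \<Longrightarrow> \<forall>s\<in>I. \<exists>v\<in>Z' s. pre M v (w s) \<Longrightarrow> \<exists>T. finite T \<and> visits M I U w Z' T"
  proof -
    have "\<exists>Z'. (\<forall>s\<in>I. good (Z' s) \<and> Z' s \<subseteq> Z s) \<and>
      (\<forall>(U, w)\<in>\<T>. (\<forall>s\<in>I. \<exists>v\<in>Z' s. pre M v (w s)) \<longrightarrow> (\<exists>T. finite T \<and> visits M I U w Z' T))"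
      by (rule insert.IH) (use insert.prems in auto)
    then obtain Z' where Z': "\<forall>s\<in>I. good (Z' s) \<and> Z' s \<subseteq> Z s"
      "\<forall>(U, w)\<in>\<T>. (\<forall>s\<in>I. \<exists>v\<in>Z' s. pre M v (w s)) \<longrightarrow> (\<exists>T. finite T \<and> visits M I U w Z' T)"
      by (elim exE conjE)
    show ?thesis by (rule that[of Z']) (use Z' in auto)
  qed
  show ?case
  proof (cases "\<forall>s\<in>I. \<exists>v\<in>Z' s. pre M v (w s)")
    case False
    then show ?thesis using Z' \<tau> by (intro exI[of _ Z']) auto
  next
    case True
    then obtain v where v: "\<And>s. s \<in> I \<Longrightarrow> v s \<in> Z' s" "\<And>s. s \<in> I \<Longrightarrow> pre M (v s) (w s)" by metis
    have U: "openin X U" "U \<noteq> {}" using insert.prems \<tau> by auto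
    have "\<exists>Z'' T. finite T \<and> (\<forall>s\<in>I. good (Z'' s) \<and> Z'' s \<subseteq> Z' s) \<and> visits M I U v Z'' T"
      by (rule exists_visits) (use assms(2) Z'(1) v(1) U in auto)
    then obtain Z'' T where "finite T" "\<forall>s\<in>I. good (Z'' s) \<and> Z'' s \<subseteq> Z' s" "visits M I U v Z'' T"
      by (elim exE conjE)
    then have Z'': "finite T" "\<And>s. s \<in> I \<Longrightarrow> good (Z'' s)" "\<And>s. s \<in> I \<Longrightarrow> Z'' s \<subseteq> Z' s"
      "visits M I U v Z'' T" by simp_all
    have "visits M I U w Z'' T" using visits_pre_cong[OF v(2) Z''(4)] .
    moreover have "\<exists>T. finite T \<and> visits M I U' w' Z'' T"
      if U'w': "(U', w') \<in> \<T>" "\<forall>s\<in>I. \<exists>v\<in>Z'' s. pre M v (w' s)" for U' w'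
    proof -
      have "\<exists>v\<in>Z' s. pre M v (w' s)" if s: "s \<in> I" for s
      proof -
        obtain v where "v \<in> Z'' s" "pre M v (w' s)"
          using U'w'(2) s by blast
        then show ?thesis using Z''(3)[OF s] by (intro bexI[of _ v]) auto
      qed
      then obtain T' where "finite T'" "visits M I U' w' Z' T'" using Z'(3)[OF U'w'(1)] by blast
      moreover from this(2) Z''(3) have "visits M I U' w' Z'' T'" by (rule visits_mono)
      ultimately show ?thesis by blast
    qed
    moreover have "Z'' s \<subseteq> Z s" if "s \<in> I" for s using Z'(2)[OF that] Z''(3)[OF that] by blast
    ultimately show ?thesis using Z''(1,2) \<tau> by (intro exI[of _ Z'']) auto
  qed
qed

end

section \<open>A tree of systems and its branches\<close>

lemma compact_symbols: "compact symbols"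
proof -
  have "symbols = PiE UNIV (\<lambda>_. {0, 1, 2})" by (auto simp: symbols_def)
  moreover have "compactin (product_topology (\<lambda>_. euclidean) UNIV) (PiE UNIV (\<lambda>_::nat. {0, 1, 2 :: real}))"
    by (simp add: compactin_PiE finite_imp_compact)
  ultimately show ?thesis by (simp add: euclidean_product_topology)
qed

lemma symbols_eq_of_close: "z \<in> symbols \<Longrightarrow> w \<in> symbols \<Longrightarrow> dist (z i) (w i) < 1 \<Longrightarrow> z i = w i"
proof -
  assume "z \<in> symbols" "w \<in> symbols" and d: "dist (z i) (w i) < 1"
  then have "z i \<in> {0, 1, 2}" "w i \<in> {0, 1, 2}" unfolding symbols_def by blast+
  then show "z i = w i" using d by (auto simp: dist_real_def)
qed

lemma closure_symbols: "Z \<subseteq> symbols \<Longrightarrow> closure Z \<subseteq> symbols"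
  using compact_imp_closed[OF compact_symbols] closure_minimal by blast

lemma open_coordinates:
  "open {f :: nat \<Rightarrow> real. \<forall>i<M. dist (y i) (f i) < 1}"
proof -
  have "open {f. \<forall>i\<in>{..<M}. f i \<in> ball (y i) 1}" by (rule product_topology_basis'[where x = id, simplified]) auto
  then show ?thesis by (simp add: Ball_def)
qed

lemma closure_pre:
  assumes "Z \<subseteq> symbols" "y \<in> closure Z"
  obtains z where "z \<in> Z" "pre M z y"
proof -
  let ?U = "{f. \<forall>i<M. dist (y i) (f i) < 1}"
  have "y \<in> ?U \<inter> closure Z" using assms(2) by simp
  then have "?U \<inter> Z \<noteq> {}" using open_Int_closure_eq_empty[OF open_coordinates, of M y Z] by blast
  then obtain z where z: "z \<in> Z" "\<And>i. i < M \<Longrightarrow> dist (y i) (z i) < 1" by blast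
  moreover have "y \<in> symbols" using assms closure_symbols by blast
  ultimately have "pre M z y" using symbols_eq_of_close[of z y] assms(1)
    by (auto simp: pre_def dist_commute)
  with z(1) that show ?thesis by blast
qed

lemma open_contains_pre:
  assumes "open U" "y \<in> U"
  obtains M where "\<And>z. pre M z y \<Longrightarrow> z \<in> U"
proof -
  obtain V where V: "finite {i. V i \<noteq> UNIV}" "y \<in> PiE UNIV V" "PiE UNIV V \<subseteq> U"
    using assms unfolding open_fun_def openin_product_topology_alt by (auto simp: Collect_conj_eq)
  obtain M where M: "\<And>i. i \<in> {i. V i \<noteq> UNIV} \<Longrightarrow> i < M"
    using V(1) by (meson finite_nat_iff_bounded lessThan_iff subset_eq)
  have "z \<in> U" if "pre M z y" for z
  proof -
    have "z i \<in> V i" for i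
    proof (cases "V i = UNIV")
      case False
      then have "z i = y i" using M that by (simp add: pre_def)
      then show ?thesis using V(2) by auto
    qed simp
    then show ?thesis using V(3) by auto
  qed
  then show ?thesis using that by blast
qed

context nat_group
begin

definition subshift :: "(nat \<Rightarrow> real) set \<Rightarrow> bool" where
  "subshift Y \<longleftrightarrow> closed Y \<and> Y \<subseteq> symbols \<and> Y \<noteq> {} \<and> (\<forall>y\<in>Y. \<forall>g. act g y \<in> Y)"

definition acts_freely :: "(nat \<Rightarrow> real) set \<Rightarrow> bool" where
  "acts_freely Y \<longleftrightarrow> (\<forall>y\<in>Y. \<forall>g. act g y = y \<longrightarrow> g = e)"

lemma continuous_act: "continuous_on UNIV (act g)"
proof (rule continuous_on_coordinatewise_then_product)
  fix i
  obtain k h where "prod_decode i = (k, h)" by fastforce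
  then have "act g z i = z (prod_encode (k, h \<cdot> g))" for z by (simp add: act_def mk_def val_def)
  then show "continuous_on UNIV (\<lambda>z. act g z i)" by simp
qed

end

definition truncate :: "nat \<Rightarrow> (nat \<Rightarrow> real) \<Rightarrow> nat \<Rightarrow> real" where
  "truncate M w i = (if i < M then w i else 0)"

definition patterns :: "nat \<Rightarrow> (nat \<Rightarrow> real) set" where
  "patterns M = {f. \<forall>i. (i \<in> {..<M} \<longrightarrow> f i \<in> {0, 1, 2}) \<and> (i \<notin> {..<M} \<longrightarrow> f i = 0)}"

lemma finite_patterns: "finite (patterns M)"
  unfolding patterns_def by (rule finite_set_of_finite_funs) auto

lemma pre_truncate: "pre M (truncate M w) w" "pre M w (truncate M w)"
  by (simp_all add: pre_def truncate_def)

definition code :: "(nat \<Rightarrow> bool) \<Rightarrow> nat \<Rightarrow> bool list" where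
  "code r i = map r [0..<i]"

lemma length_code [simp]: "length (code r i) = i"
  by (simp add: code_def)

lemma take_code: "take i (code r (Suc i)) = code r i"
  by (simp add: code_def)

lemma code_eq_mono: "code r i = code r' i \<Longrightarrow> j \<le> i \<Longrightarrow> code r j = code r' j"
  by (auto simp: code_def list_eq_iff_nth_eq)

lemma codes_distinct:
  assumes "finite J"
  obtains i where "i \<ge> n" "inj_on (\<lambda>r. code r i) J"
proof -
  have "\<forall>r\<in>J. \<forall>r'\<in>J. \<exists>i. r \<noteq> r' \<longrightarrow> code r (Suc i) \<noteq> code r' (Suc i)"
    by (auto simp: code_def)
  then obtain d where d: "\<And>r r'. r \<in> J \<Longrightarrow> r' \<in> J \<Longrightarrow> r \<noteq> r' \<Longrightarrow> code r (Suc (d r r')) \<noteq> code r' (Suc (d r r'))"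
    by metis
  define i where "i = n + (\<Sum>r\<in>J. \<Sum>r'\<in>J. Suc (d r r'))"
  have "inj_on (\<lambda>r. code r i) J"
  proof (rule inj_onI, rule ccontr)
    fix r r' assume r: "r \<in> J" "r' \<in> J" "code r i = code r' i" "r \<noteq> r'"
    have "Suc (d r r') \<le> (\<Sum>r'\<in>J. Suc (d r r'))" using assms r by (intro member_le_sum) auto
    also have "\<dots> \<le> (\<Sum>r\<in>J. \<Sum>r'\<in>J. Suc (d r r'))" using assms r by (intro member_le_sum[of r]) auto
    finally have "Suc (d r r') \<le> i" by (simp add: i_def)
    with code_eq_mono[OF r(3)] d r show False by blast
  qed
  moreover have "i \<ge> n" by (simp add: i_def)
  ultimately show ?thesis using that by blast
qed

context nat_flow
begin

definition jointly_minimal :: "('i \<Rightarrow> (nat \<Rightarrow> real) set) \<Rightarrow> bool" where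
  "jointly_minimal Y \<longleftrightarrow> (\<forall>J x U y v M. finite J \<and> x \<in> topspace X \<and> openin X U \<and> U \<noteq> {} \<and>
     (\<forall>i\<in>J. y i \<in> Y i \<and> v i \<in> Y i) \<longrightarrow> (\<exists>t. a t x \<in> U \<and> (\<forall>i\<in>J. pre M (act t (y i)) (v i))))"

lemma jointly_minimalD:
  assumes "jointly_minimal Y" "finite J" "x \<in> topspace X" "openin X U" "U \<noteq> {}"
    "\<And>i. i \<in> J \<Longrightarrow> y i \<in> Y i" "\<And>i. i \<in> J \<Longrightarrow> v i \<in> Y i"
  shows "\<exists>t. a t x \<in> U \<and> (\<forall>i\<in>J. pre M (act t (y i)) (v i))"
  using assms(1)[unfolded jointly_minimal_def, rule_format, of J x U y v M] assms(2-7) by blast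

theorem exists_branches:
  fixes B :: "nat \<Rightarrow> 'x set"
  assumes B: "\<And>j. openin X (B j)" "\<And>j. B j \<noteq> {}" "\<And>U. openin X U \<Longrightarrow> U \<noteq> {} \<Longrightarrow> \<exists>j. B j \<subseteq> U"
  shows "\<exists>Y :: (nat \<Rightarrow> bool) \<Rightarrow> (nat \<Rightarrow> real) set.
    (\<forall>r. subshift (Y r) \<and> acts_freely (Y r)) \<and> jointly_minimal Y"
proof -
  define I where "I i = {s :: bool list. length s = i}" for i
  have finI: "finite (I i)" for i using finite_lists_length_eq[of "UNIV :: bool set" i] by (simp add: I_def)
  define \<T> where "\<T> i = B ` {..i} \<times> PiE (I i) (\<lambda>_. patterns i)" for i
  have fin\<T>: "finite (\<T> i)" for i
    unfolding \<T>_def by (intro finite_SigmaI finite_imageI finite_PiE finI finite_patterns) auto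
  define fulfilled where "fulfilled i F \<longleftrightarrow> (\<forall>(U, w)\<in>\<T> i. (\<forall>s\<in>I i. \<exists>v\<in>F s. pre i v (w s)) \<longrightarrow>
    (\<exists>T. finite T \<and> visits i (I i) U w F T))" for i F
  have "\<exists>F. \<forall>i. (\<forall>s\<in>I i. good (F i s)) \<and>
    ((\<forall>s\<in>I (Suc i). F (Suc i) s \<subseteq> F i (take i s) \<and> moves i (F (Suc i) s)) \<and> fulfilled (Suc i) (F (Suc i)))"
  proof (rule dependent_nat_choice)
    show "\<exists>F. \<forall>s\<in>I 0. good (F s)" using good_all by (intro exI[of _ "\<lambda>_. symbols"]) simp
    fix F i assume F: "\<forall>s\<in>I i. good (F s)"
    have "\<exists>Z. good Z \<and> Z \<subseteq> F (take i s) \<and> moves i Z" if "s \<in> I (Suc i)" for s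
      using F that by (intro good_moves) (simp add: I_def)
    then obtain Z where Z: "\<And>s. s \<in> I (Suc i) \<Longrightarrow> good (Z s) \<and> Z s \<subseteq> F (take i s) \<and> moves i (Z s)" by metis
    have "\<exists>Z'. (\<forall>s\<in>I (Suc i). good (Z' s) \<and> Z' s \<subseteq> Z s) \<and> fulfilled (Suc i) Z'"
      unfolding fulfilled_def
      by (rule exists_visits_all[OF fin\<T> finI]) (use Z B in \<open>auto simp: \<T>_def\<close>)
    then obtain Z' where Z': "\<forall>s\<in>I (Suc i). good (Z' s) \<and> Z' s \<subseteq> Z s" "fulfilled (Suc i) Z'" by blast
    have "Z' s \<subseteq> F (take i s) \<and> moves i (Z' s)" if "s \<in> I (Suc i)" for s
      using Z[OF that] bspec[OF Z'(1) that] moves_mono by blast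
    with Z' show "\<exists>F'. (\<forall>s\<in>I (Suc i). good (F' s)) \<and>
       ((\<forall>s\<in>I (Suc i). F' s \<subseteq> F (take i s) \<and> moves i (F' s)) \<and> fulfilled (Suc i) F')"
      by blast
  qed
  then obtain F where F: "\<And>i s. s \<in> I i \<Longrightarrow> good (F i s)"
    "\<And>i s. s \<in> I (Suc i) \<Longrightarrow> F (Suc i) s \<subseteq> F i (take i s)"
    "\<And>i s. s \<in> I (Suc i) \<Longrightarrow> moves i (F (Suc i) s)" "\<And>i. fulfilled (Suc i) (F (Suc i))"
    by metis
  have code_I: "code r i \<in> I i" for r i by (simp add: I_def)
  define Y where "Y r = (\<Inter>i. closure (F i (code r i)))" for r
  have Fsym: "F i (code r i) \<subseteq> symbols" for r i using good_symbols F(1) code_I by blast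
  have Y_pre: "\<exists>z\<in>F i (code r i). pre M z y" if "y \<in> Y r" for r i M y
    using closure_pre[OF Fsym] that unfolding Y_def by (metis INT_E UNIV_I)
  show ?thesis
  proof (intro exI[of _ Y] conjI allI)
    fix r
    have "closed (Y r)" by (simp add: Y_def closed_INT)
    moreover have "Y r \<subseteq> symbols" using closure_symbols[OF Fsym[of 0 r]] by (auto simp: Y_def)
    moreover have anti: "F j (code r j) \<subseteq> F i (code r i)" if "i \<le> j" for i j
      using that
    proof (induction rule: dec_induct)
      case (step k)
      then show ?case using F(2)[OF code_I[of r "Suc k"]] by (simp add: take_code)
    qed simp
    have "symbols \<inter> \<Inter>(range (\<lambda>i. closure (F i (code r i)))) \<noteq> {}"
    proof (rule compact_imp_fip[OF compact_symbols])
      fix \<F> assume "finite \<F>" "\<F> \<subseteq> range (\<lambda>i. closure (F i (code r i)))"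
      then obtain A where A: "finite A" "\<F> = (\<lambda>i. closure (F i (code r i))) ` A"
        by (meson finite_subset_image)
      obtain m where m: "\<And>i. i \<in> A \<Longrightarrow> i \<le> m" using Max_ge[OF A(1)] by blast
      obtain z where z: "z \<in> F m (code r m)" using good_nonempty[OF F(1)[OF code_I]] by blast
      have "z \<in> closure (F i (code r i))" if "i \<in> A" for i
        using subsetD[OF anti[OF m[OF that]] z] closure_subset by (rule rev_subsetD)
      then have "z \<in> \<Inter>\<F>" unfolding A(2) by simp
      moreover have "z \<in> symbols" by (rule subsetD[OF Fsym z])
      ultimately show "symbols \<inter> \<Inter>\<F> \<noteq> {}" by blast
    qed auto
    then have "Y r \<noteq> {}" by (auto simp: Y_def)
    moreover have "act g y \<in> Y r" if "y \<in> Y r" for g y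
    proof -
      have "act g ` closure (F i (code r i)) \<subseteq> closure (F i (code r i))" for i
      proof (rule image_closure_subset)
        show "continuous_on (closure (F i (code r i))) (act g)"
          using continuous_act continuous_on_subset by blast
        show "act g ` F i (code r i) \<subseteq> closure (F i (code r i))"
          using good_act[OF F(1)[OF code_I]] closure_subset by blast
      qed simp
      with that show ?thesis by (auto simp: Y_def)
    qed
    ultimately show "subshift (Y r)" by (simp add: subshift_def)
    have "g = e" if y: "y \<in> Y r" "act g y = y" for g y
    proof (rule ccontr)
      assume "g \<noteq> e"
      then obtain k where k: "\<And>z. z \<in> F (Suc g) (code r (Suc g)) \<Longrightarrow> val z k g \<noteq> val z k e"
        using F(3)[OF code_I[of r "Suc g"]] by (auto simp: moves_def)
      define M where "M = Suc (prod_encode (k, g) + prod_encode (k, e))"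
      obtain z where z: "z \<in> F (Suc g) (code r (Suc g))" "pre M z y" using Y_pre[OF y(1)] by blast
      then have "val z k g = val y k g" "val z k e = val y k e" by (auto simp: pre_def M_def val_def)
      moreover have "val y k g = val y k e" using arg_cong[OF y(2), of "\<lambda>z. val z k e"] by simp
      ultimately show False using k[OF z(1)] by simp
    qed
    then show "acts_freely (Y r)" by (simp add: acts_freely_def)
  next
    show "jointly_minimal Y"
      unfolding jointly_minimal_def
    proof (intro allI impI, elim conjE)
      fix J x U y v M
      assume J: "finite J" and x: "x \<in> topspace X" and U: "openin X U" "U \<noteq> {}"
        and yv: "\<forall>r\<in>J. y r \<in> Y r \<and> v r \<in> Y r"
      have y: "y r \<in> Y r" and v: "v r \<in> Y r" if "r \<in> J" for r using yv that by blast+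
      obtain j where j: "B j \<subseteq> U" using B(3)[OF U] by blast
      obtain i where i: "i \<ge> Suc (M + j)" "inj_on (\<lambda>r. code r i) J" using codes_distinct[OF J] .
      then obtain i' where i': "i = Suc i'" by (cases i) auto
      have "\<forall>s\<in>I i. \<exists>u. u \<in> F i s" using good_nonempty F(1) by blast
      then obtain u where u: "\<And>s. s \<in> I i \<Longrightarrow> u s \<in> F i s" by metis
      define br where "br s = (THE r. r \<in> J \<and> code r i = s)" for s
      have br: "br (code r i) = r" if "r \<in> J" for r
        unfolding br_def using that i(2) by (auto simp: inj_on_def)
      define w where "w = (\<lambda>s\<in>I i. truncate i (if s \<in> (\<lambda>r. code r i) ` J then v (br s) else u s))"
      have occ: "\<exists>v\<in>F i s. pre i v (w s)" if s: "s \<in> I i" for s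
      proof (cases "s \<in> (\<lambda>r. code r i) ` J")
        case True
        then obtain r where r: "r \<in> J" "s = code r i" by blast
        obtain z where z: "z \<in> F i s" "pre i z (v r)" using Y_pre[OF v[OF r(1)]] r(2) by blast
        then have "pre i z (w s)"
          using True s br[OF r(1)] r(2) pre_trans pre_truncate(2) by (auto simp: w_def)
        with z(1) show ?thesis by blast
      next
        case False
        then show ?thesis using u[OF s] s pre_truncate(2) by (intro bexI[of _ "u s"]) (auto simp: w_def)
      qed
      have "w s \<in> patterns i" if s: "s \<in> I i" for s
      proof -
        obtain z where "z \<in> F i s" "pre i z (w s)" using occ[OF s] by blast
        moreover from this(1) have "z k \<in> {0, 1, 2}" for k
          using good_symbols[OF F(1)[OF s]] unfolding symbols_def by blast
        ultimately have "w s k \<in> {0, 1, 2}" if "k < i" for k using that by (metis pre_def)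
        moreover have "w s k = 0" if "\<not> k < i" for k using s that by (simp add: w_def truncate_def)
        ultimately show ?thesis by (simp add: patterns_def)
      qed
      then have "(B j, w) \<in> \<T> i" using i by (auto simp: \<T>_def w_def)
      then obtain T where T: "finite T" "visits i (I i) (B j) w (F i) T"
        using F(4)[of i'] occ unfolding i'[symmetric] fulfilled_def by blast
      obtain M' where M': "\<And>z w t. t \<in> T \<Longrightarrow> pre M' z w \<Longrightarrow> pre i (act t z) (act t w)"
        using act_pre_uniform[OF T(1)] by blast
      have "\<forall>r\<in>J. \<exists>z. z \<in> F i (code r i) \<and> pre M' z (y r)" using Y_pre y by blast
      then obtain z where z: "\<And>r. r \<in> J \<Longrightarrow> z r \<in> F i (code r i)" "\<And>r. r \<in> J \<Longrightarrow> pre M' (z r) (y r)" by metis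
      define zs where "zs s = (if s \<in> (\<lambda>r. code r i) ` J then z (br s) else u s)" for s
      have "\<forall>s\<in>I i. zs s \<in> F i s" using z(1) u br by (auto simp: zs_def)
      then obtain t where t: "t \<in> T" "a t x \<in> B j" "\<forall>s\<in>I i. pre i (act t (zs s)) (w s)"
        using T(2) x unfolding visits_def by blast
      have "pre M (act t (y r)) (v r)" if r: "r \<in> J" for r
      proof -
        have "zs (code r i) = z r" using r br by (simp add: zs_def)
        then have "pre i (act t (z r)) (w (code r i))" using t(3) code_I by metis
        moreover have "w (code r i) = truncate i (v r)" using r br code_I by (simp add: w_def)
        ultimately have "pre i (act t (z r)) (v r)" using pre_trans pre_truncate(1) by metis
        moreover have "pre i (act t (y r)) (act t (z r))" using M'[OF t(1) z(2)[OF r]] by (rule pre_sym)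
        ultimately have "pre i (act t (y r)) (v r)" using pre_trans by blast
        then show ?thesis using i by (rule_tac pre_mono) auto
      qed
      with t(2) j show "\<exists>t. a t x \<in> U \<and> (\<forall>r\<in>J. pre M (act t (y r)) (v r))" by blast
    qed
  qed
qed

end

section \<open>Back to flows of the given group\<close>

locale enumerated_group = nat_group mul e iv
  for mul :: "nat \<Rightarrow> nat \<Rightarrow> nat" (infixl "\<cdot>" 70) and e iv +
  fixes G :: "('g, 'b) monoid_scheme" and \<phi> :: "nat \<Rightarrow> 'g" and \<psi> :: "'g \<Rightarrow> nat"
  assumes group_G: "Group.group G"
    and \<phi>_\<psi> [simp]: "g \<in> carrier G \<Longrightarrow> \<phi> (\<psi> g) = g"
    and \<psi>_\<phi> [simp]: "\<psi> (\<phi> n) = n"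
    and \<phi>_carrier [simp]: "\<phi> n \<in> carrier G"
    and \<phi>_mul: "\<phi> (m \<cdot> n) = \<phi> m \<otimes>\<^bsub>G\<^esub> \<phi> n"
    and \<phi>_e: "\<phi> e = \<one>\<^bsub>G\<^esub>"

lemma exists_enumerated_group:
  assumes "Group.group G" "countable (carrier G)" "infinite (carrier G)"
  shows "\<exists>mul e iv \<phi> \<psi>. enumerated_group mul e iv G \<phi> \<psi>"
proof -
  interpret G: Group.group G by (rule assms)
  define \<phi> where "\<phi> = from_nat_into (carrier G)"
  define \<psi> where "\<psi> = to_nat_on (carrier G)"
  have \<phi>: "\<phi> n \<in> carrier G" for n
    using from_nat_into[of "carrier G"] assms(3) by (auto simp: \<phi>_def)
  have \<phi>\<psi>: "\<phi> (\<psi> g) = g" if "g \<in> carrier G" for g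
    using that assms by (simp add: \<phi>_def \<psi>_def)
  have \<psi>\<phi>: "\<psi> (\<phi> n) = n" for n
    using assms by (simp add: \<phi>_def \<psi>_def to_nat_on_from_nat_into_infinite)
  have "enumerated_group (\<lambda>m n. \<psi> (\<phi> m \<otimes>\<^bsub>G\<^esub> \<phi> n)) (\<psi> \<one>\<^bsub>G\<^esub>) (\<lambda>n. \<psi> (m_inv G (\<phi> n))) G \<phi> \<psi>"
    by unfold_locales (simp_all add: \<phi> \<phi>\<psi> \<psi>\<phi> G.m_assoc assms(1))
  then show ?thesis by blast
qed

context enumerated_group
begin

lemma \<psi>_mult: "g \<in> carrier G \<Longrightarrow> h \<in> carrier G \<Longrightarrow> \<psi> (g \<otimes>\<^bsub>G\<^esub> h) = \<psi> g \<cdot> \<psi> h"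
  by (metis \<phi>_\<psi> \<phi>_mul \<psi>_\<phi>)

lemma \<psi>_one: "\<psi> \<one>\<^bsub>G\<^esub> = e"
  by (metis \<phi>_e \<psi>_\<phi>)

lemma nat_flow_of_minimal_flow:
  assumes "minimal_flow G X a"
  shows "nat_flow mul e iv X (\<lambda>n. a (\<phi> n))"
proof
  have flow: "G_flow G X a" using assms by (simp add: minimal_flow_def)
  show "compact_space X" "topspace X \<noteq> {}" "\<And>g. continuous_map X X (a (\<phi> g))"
    "\<And>x. x \<in> topspace X \<Longrightarrow> a (\<phi> e) x = x"
    "\<And>x g h. x \<in> topspace X \<Longrightarrow> a (\<phi> (g \<cdot> h)) x = a (\<phi> g) (a (\<phi> h) x)"
    using flow by (simp_all add: G_flow_def \<phi>_mul \<phi>_e)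
  fix x U assume x: "x \<in> topspace X" and U: "openin X U" "U \<noteq> {}"
  then obtain u where u: "u \<in> U" "u \<in> topspace X" using openin_subset by blast
  with assms x have "u \<in> X closure_of orbit G a x" by (simp add: minimal_flow_def)
  with u(1) U(1) obtain y where "y \<in> orbit G a x" "y \<in> U" by (auto simp: in_closure_of)
  then show "\<exists>g. a (\<phi> g) x \<in> U" unfolding orbit_def by (metis \<phi>_\<psi> imageE)
qed

definition subshift_action :: "'g \<Rightarrow> (nat \<Rightarrow> real) \<Rightarrow> nat \<Rightarrow> real" where
  "subshift_action g = act (\<psi> g)"

lemma subshift_flow:
  assumes "subshift Y"
  shows "G_flow G (top_of_set Y) subshift_action"
proof -
  have "compact Y"
    using compact_Int_closed[OF compact_symbols, of Y] assms by (simp add: subshift_def Int_absorb1)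
  then have "compact_space (top_of_set Y)" by (simp add: compact_space_subtopology)
  moreover have "continuous_map (top_of_set Y) (top_of_set Y) (subshift_action g)" for g
    using assms continuous_on_subset[OF continuous_act]
    by (auto simp: subshift_def subshift_action_def)
  ultimately show ?thesis
    using assms group_G
    by (auto simp: G_flow_def subshift_def subshift_action_def \<psi>_mult \<psi>_one Hausdorff_space_subtopology)
qed

lemma metrizable_subshift: "metrizable_space (top_of_set (Y :: (nat \<Rightarrow> real) set))"
  by (simp add: metrizable_space_subtopology metrizable_space_euclidean)

lemma subshift_open_contains_pre:
  assumes "openin (top_of_set Y) W" "y \<in> W"
  obtains M where "\<And>z. z \<in> Y \<Longrightarrow> pre M z y \<Longrightarrow> z \<in> W"
proof -
  obtain O' where "open O'" "W = Y \<inter> O'" using assms(1) by (auto simp: openin_open)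
  moreover then obtain M where "\<And>z. pre M z y \<Longrightarrow> z \<in> O'" using open_contains_pre assms(2) by blast
  ultimately show ?thesis using that by blast
qed

lemma subshift_minimal:
  assumes Y: "subshift Y" and visit: "\<And>y v M. y \<in> Y \<Longrightarrow> v \<in> Y \<Longrightarrow> \<exists>t. pre M (act t y) v"
  shows "minimal_flow G (top_of_set Y) subshift_action"
proof -
  have "v \<in> top_of_set Y closure_of orbit G subshift_action y" if yv: "y \<in> Y" "v \<in> Y" for y v
    unfolding in_closure_of
  proof (intro conjI allI impI)
    fix W assume W: "v \<in> W \<and> openin (top_of_set Y) W"
    then obtain M where M: "\<And>z. z \<in> Y \<Longrightarrow> pre M z v \<Longrightarrow> z \<in> W"
      using subshift_open_contains_pre by blast
    obtain t where "pre M (act t y) v" using visit[OF yv] by blast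
    then have "act t y \<in> W" using M Y yv by (auto simp: subshift_def)
    moreover have "act t y \<in> orbit G subshift_action y"
      unfolding orbit_def subshift_action_def by (rule image_eqI[of _ _ "\<phi> t"]) auto
    ultimately show "\<exists>z. z \<in> orbit G subshift_action y \<and> z \<in> W" by blast
  qed (use yv in auto)
  then show ?thesis
    using subshift_flow[OF Y] closure_of_subset_topspace[of "top_of_set Y"]
    unfolding minimal_flow_def by auto
qed

lemma subshift_free:
  assumes Y: "subshift Y" and free: "acts_freely Y"
  shows "free_flow G (top_of_set Y) subshift_action"
  unfolding free_flow_def
proof (intro conjI ballI inj_onI)
  fix y g h assume y: "y \<in> topspace (top_of_set Y)" and gh: "g \<in> carrier G" "h \<in> carrier G"
    and eq: "subshift_action g y = subshift_action h y"
  have "act (iv (\<psi> h) \<cdot> \<psi> g) y = act (iv (\<psi> h)) (act (\<psi> h) y)"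
    using eq by (simp add: subshift_action_def flip: act_act)
  then have "iv (\<psi> h) \<cdot> \<psi> g = e" using free y by (simp add: acts_freely_def)
  then have "\<psi> h \<cdot> (iv (\<psi> h) \<cdot> \<psi> g) = \<psi> h" by (simp only: right_neutral)
  then have "\<psi> g = \<psi> h" by simp
  then show "g = h" using gh by (metis \<phi>_\<psi>)
qed (rule subshift_flow[OF Y])

lemma subshift_disjoint:
  assumes X: "G_flow G X a" and Y: "subshift Y"
    and visit: "\<And>x U y v M. x \<in> topspace X \<Longrightarrow> openin X U \<Longrightarrow> U \<noteq> {} \<Longrightarrow> y \<in> Y \<Longrightarrow> v \<in> Y \<Longrightarrow>
      \<exists>t. a (\<phi> t) x \<in> U \<and> pre M (act t y) v"
  shows "disjoint_flows G X a (top_of_set Y) subshift_action"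
  unfolding disjoint_flows_def
proof (intro allI impI, elim conjE)
  fix Z assume Z: "closedin (prod_topology X (top_of_set Y)) Z"
    "\<forall>g\<in>carrier G. \<forall>p\<in>Z. (a g (fst p), subshift_action g (snd p)) \<in> Z"
    "fst ` Z = topspace X" "snd ` Z = topspace (top_of_set Y)"
  have "topspace X \<noteq> {}" using X by (simp add: G_flow_def)
  then obtain x y where xy: "(x, y) \<in> Z" using Z(3) by (metis equals0I image_is_empty surj_pair)
  have sub: "Z \<subseteq> topspace X \<times> Y" using closedin_subset[OF Z(1)] by simp
  have "p \<in> Z" if p: "p \<in> topspace X \<times> Y" for p
  proof -
    obtain x' v where p': "p = (x', v)" "x' \<in> topspace X" "v \<in> Y" using p by auto
    have "p \<in> prod_topology X (top_of_set Y) closure_of Z"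
      unfolding in_closure_of
    proof (intro conjI allI impI)
      fix T assume T: "p \<in> T \<and> openin (prod_topology X (top_of_set Y)) T"
      then obtain U V where UV: "openin X U" "openin (top_of_set Y) V" "x' \<in> U" "v \<in> V" "U \<times> V \<subseteq> T"
        unfolding openin_prod_topology_alt p' by blast
      obtain M where M: "\<And>z. z \<in> Y \<Longrightarrow> pre M z v \<Longrightarrow> z \<in> V"
        using subshift_open_contains_pre[OF UV(2,4)] by blast
      obtain t where t: "a (\<phi> t) x \<in> U" "pre M (act t y) v"
        using visit[OF _ UV(1), of x y v M] UV(3) xy sub p' by blast
      have "act t y \<in> V" using M t(2) xy sub Y by (auto simp: subshift_def)
      moreover have "(a (\<phi> t) x, act t y) \<in> Z"
        using bspec[OF bspec[OF Z(2) \<phi>_carrier[of t]] xy] by (simp add: subshift_action_def)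
      ultimately show "\<exists>y. y \<in> Z \<and> y \<in> T" using t(1) UV(5) by blast
    qed (use p in auto)
    then show ?thesis using closure_of_closedin[OF Z(1)] by simp
  qed
  with sub show "Z = topspace X \<times> topspace (top_of_set Y)" by auto
qed

lemma product_flow:
  assumes "\<And>i. i \<in> I \<Longrightarrow> G_flow G (X i) (a i)"
  shows "G_flow G (product_topology X I) (diag_action I a)"
proof -
  have "continuous_map (product_topology X I) (product_topology X I) (diag_action I a g)"
    if g: "g \<in> carrier G" for g
    unfolding continuous_map_componentwise
  proof (intro conjI ballI)
    fix i assume i: "i \<in> I"
    have "continuous_map (product_topology X I) (X i) (a i g \<circ> (\<lambda>f. f i))"
      using assms[OF i] g i
      by (intro continuous_map_compose[OF continuous_map_product_projection]) (auto simp: G_flow_def)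
    then show "continuous_map (product_topology X I) (X i) (\<lambda>x. diag_action I a g x i)"
      using i by (simp add: diag_action_def o_def)
  qed (auto simp: diag_action_def)
  moreover have "topspace (product_topology X I) \<noteq> {}"
    using assms by (auto simp: PiE_eq_empty_iff G_flow_def)
  moreover have "diag_action I a \<one>\<^bsub>G\<^esub> f = f" if "f \<in> topspace (product_topology X I)" for f
    using that assms by (auto simp: diag_action_def G_flow_def fun_eq_iff PiE_iff extensional_def)
  moreover have "diag_action I a (g \<otimes>\<^bsub>G\<^esub> h) f = diag_action I a g (diag_action I a h f)"
    if "g \<in> carrier G" "h \<in> carrier G" "f \<in> topspace (product_topology X I)" for g h f
    using that assms by (auto simp: diag_action_def G_flow_def fun_eq_iff PiE_iff)
  moreover have "compact_space (product_topology X I)" "Hausdorff_space (product_topology X I)"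
    using assms by (auto simp: compact_space_product_topology Hausdorff_space_product_topology G_flow_def)
  ultimately show ?thesis using group_G by (simp add: G_flow_def)
qed

lemma product_of_subshifts_minimal:
  assumes Y: "\<And>i. subshift (Y i)"
    and visit: "\<And>J y v M. finite J \<Longrightarrow> (\<And>i. y i \<in> Y i) \<Longrightarrow> (\<And>i. v i \<in> Y i) \<Longrightarrow>
      \<exists>t. \<forall>i\<in>J. pre M (act t (y i)) (v i)"
  shows "minimal_flow G (product_topology (\<lambda>i. top_of_set (Y i)) UNIV) (diag_action UNIV (\<lambda>_. subshift_action))"
    (is "minimal_flow G ?P ?a")
proof -
  have top: "topspace ?P = {f. \<forall>i. f i \<in> Y i}" by auto
  have "v \<in> ?P closure_of orbit G ?a y" if y: "\<And>i. y i \<in> Y i" and v: "\<And>i. v i \<in> Y i" for y v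
    unfolding in_closure_of
  proof (intro conjI allI impI)
    fix T assume "v \<in> T \<and> openin ?P T"
    then obtain U where U: "finite {i. U i \<noteq> Y i}" "\<And>i. openin (top_of_set (Y i)) (U i)"
      "v \<in> Pi\<^sub>E UNIV U" "Pi\<^sub>E UNIV U \<subseteq> T"
      unfolding openin_product_topology_alt by auto
    define J where "J = {i. U i \<noteq> Y i}"
    have "\<exists>M. \<forall>z. z \<in> Y i \<longrightarrow> pre M z (v i) \<longrightarrow> z \<in> U i" for i
      using subshift_open_contains_pre[OF U(2)] U(3) by (metis PiE_mem UNIV_I)
    then obtain M where M: "\<And>i z. z \<in> Y i \<Longrightarrow> pre (M i) z (v i) \<Longrightarrow> z \<in> U i" by metis
    have J: "finite J" using U(1) by (simp add: J_def)
    obtain t where t: "\<And>i. i \<in> J \<Longrightarrow> pre (\<Sum>i\<in>J. M i) (act t (y i)) (v i)"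
      using visit[OF J y v] by blast
    have "act t (y i) \<in> U i" for i
    proof (cases "i \<in> J")
      case True
      then have "M i \<le> (\<Sum>i\<in>J. M i)" using J by (intro member_le_sum) auto
      then show ?thesis using M t[OF True] pre_mono Y y by (metis subshift_def)
    next
      case False
      then show ?thesis using Y y by (simp add: J_def subshift_def)
    qed
    then have "?a (\<phi> t) y \<in> T"
      using U(4) by (auto simp: diag_action_def subshift_action_def)
    then show "\<exists>z. z \<in> orbit G ?a y \<and> z \<in> T" by (auto simp: orbit_def)
  qed (use v in auto)
  then have "?P closure_of orbit G ?a y = topspace ?P" if "y \<in> topspace ?P" for y
    using that closure_of_subset_topspace[of ?P] unfolding top by blast
  moreover have "G_flow G ?P ?a" by (rule product_flow) (rule subshift_flow[OF Y])
  ultimately show ?thesis unfolding minimal_flow_def by blast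
qed

end

lemma metrizable_compact_pi_base:
  assumes "compact_space X" "metrizable_space X" "topspace X \<noteq> {}"
  obtains B :: "nat \<Rightarrow> 'x set" where "\<And>j. openin X (B j)" "\<And>j. B j \<noteq> {}"
    "\<And>U. openin X U \<Longrightarrow> U \<noteq> {} \<Longrightarrow> \<exists>j. B j \<subseteq> U"
proof -
  obtain m d where "Metric_space m d" and X: "X = Metric_space.mtopology m d"
    using assms(2) by (auto simp: metrizable_space_def)
  interpret Metric_space m d by fact
  have "mtotally_bounded m"
    using assms(1) compactin_imp_mtotally_bounded by (simp add: X compact_space_def)
  then have "\<exists>K. finite K \<and> K \<subseteq> m \<and> m \<subseteq> (\<Union>x\<in>K. mball x (1 / real (Suc n)))" for n
    unfolding mtotally_bounded_def by simp
  then obtain K where K: "\<And>n. finite (K n)" "\<And>n. K n \<subseteq> m" "\<And>n. m \<subseteq> (\<Union>x\<in>K n. mball x (1 / real (Suc n)))"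
    by metis
  define \<B> where "\<B> = (\<Union>n. (\<lambda>x. mball x (1 / real (Suc n))) ` K n)"
  have "countable \<B>" unfolding \<B>_def using K(1) by (auto intro: countable_finite)
  have open\<B>: "openin X V \<and> V \<noteq> {}" if "V \<in> \<B>" for V
    using that K(2) by (fastforce simp: \<B>_def X)
  have small: "\<exists>V\<in>\<B>. V \<subseteq> U" if U: "openin X U" "U \<noteq> {}" for U
  proof -
    obtain y where y: "y \<in> U" using U by blast
    then obtain r where r: "r > 0" "mball y r \<subseteq> U" "y \<in> m"
      using U(1) unfolding X openin_mtopology by blast
    obtain n where n: "1 / real (Suc n) < r / 2" using r(1) by (meson half_gt_zero nat_approx_posE)
    obtain x where x: "x \<in> K n" "y \<in> mball x (1 / real (Suc n))" using K(3) r(3) by blast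
    have "mball x (1 / real (Suc n)) \<subseteq> mball y r"
    proof
      fix z assume z: "z \<in> mball x (1 / real (Suc n))"
      then have "d y z \<le> d x y + d x z" using x(2) triangle[of y x z] commute by (auto simp: in_mball)
      then show "z \<in> mball y r" using x(2) z n by (auto simp: in_mball)
    qed
    then show ?thesis using x(1) r(2) by (auto simp: \<B>_def)
  qed
  have "\<B> \<noteq> {}" using small[of "topspace X"] assms(3) by auto
  then have range: "range (from_nat_into \<B>) = \<B>" using \<open>countable \<B>\<close> by (simp add: range_from_nat_into)
  show ?thesis
  proof (rule that[of "from_nat_into \<B>"])
    show "openin X (from_nat_into \<B> j)" "from_nat_into \<B> j \<noteq> {}" for j
      using open\<B>[OF from_nat_into[OF \<open>\<B> \<noteq> {}\<close>]] by auto
    show "\<exists>j. from_nat_into \<B> j \<subseteq> U" if "openin X U" "U \<noteq> {}" for U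
      using small[OF that] range by (metis imageE)
  qed
qed

definition cut :: "real \<Rightarrow> nat \<Rightarrow> bool" where
  "cut x n \<longleftrightarrow> x < of_rat (from_nat n)"

lemma inj_cut: "inj cut"
proof (rule injI, rule ccontr)
  fix x y :: real assume eq: "cut x = cut y" and "x \<noteq> y"
  have "\<exists>q. min x y < of_rat q \<and> of_rat q < max x y" using \<open>x \<noteq> y\<close> of_rat_dense[of "min x y" "max x y"] by auto
  then obtain q where q: "min x y < of_rat q" "of_rat q < max x y" by blast
  have "cut x (to_nat q) = cut y (to_nat q)" using eq by simp
  with q show False by (auto simp: cut_def min_def max_def split: if_splits)
qed

theorem theorem1p2:
  fixes G :: "('g, 'b) monoid_scheme"
  assumes "group G" and "countable (carrier G)" and "infinite (carrier G)"
  shows "(\<forall>(X :: 'x topology) a. minimal_flow G X a \<and> metrizable_space X \<longrightarrow>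
            (\<exists>(Y :: (nat \<Rightarrow> real) topology) b.
               minimal_flow G Y b \<and> metrizable_space Y \<and> free_flow G Y b \<and>
               disjoint_flows G X a Y b))
       \<and> (\<exists>(Xs :: real \<Rightarrow> (nat \<Rightarrow> real) topology) as.
            mutually_disjoint G UNIV Xs as \<and>
            (\<forall>r. free_flow G (Xs r) (as r) \<and> metrizable_space (Xs r) \<and> minimal_flow G (Xs r) (as r)))"
proof -
  obtain mul e iv \<phi> \<psi> where "enumerated_group mul e iv G \<phi> \<psi>"
    using exists_enumerated_group[OF assms] by blast
  then interpret enumerated_group mul e iv G \<phi> \<psi> .
  show ?thesis
  proof (intro conjI allI impI)
    fix X :: "'x topology" and a
    assume X: "minimal_flow G X a \<and> metrizable_space X"
    then have flow: "G_flow G X a" by (simp add: minimal_flow_def)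
    interpret X: nat_flow mul e iv X "\<lambda>n. a (\<phi> n)" using X nat_flow_of_minimal_flow by blast
    obtain B :: "nat \<Rightarrow> 'x set" where B: "\<And>j. openin X (B j)" "\<And>j. B j \<noteq> {}"
      "\<And>U. openin X U \<Longrightarrow> U \<noteq> {} \<Longrightarrow> \<exists>j. B j \<subseteq> U"
      using metrizable_compact_pi_base[OF X.compact _ X.nonempty] X by blast
    obtain Y :: "(nat \<Rightarrow> bool) \<Rightarrow> (nat \<Rightarrow> real) set" where Y: "\<And>r. subshift (Y r)"
      "\<And>r. acts_freely (Y r)" "X.jointly_minimal Y"
      using X.exists_branches[OF B] by auto
    define r0 :: "nat \<Rightarrow> bool" where "r0 = (\<lambda>_. False)"
    note sub = Y(1)[of r0]
    have visit: "\<exists>t. a (\<phi> t) x \<in> U \<and> pre M (act t y) v"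
      if "x \<in> topspace X" "openin X U" "U \<noteq> {}" "y \<in> Y r0" "v \<in> Y r0" for x U y v M
      using X.jointly_minimalD[OF Y(3), of "{r0}" x U "\<lambda>_. y" "\<lambda>_. v" M] that by auto
    have "\<exists>t. pre M (act t y) v" if "y \<in> Y r0" "v \<in> Y r0" for y v M
    proof -
      obtain x where "x \<in> topspace X" using X.nonempty by blast
      then show ?thesis using visit[OF _ openin_topspace X.nonempty that] by blast
    qed
    then have "minimal_flow G (top_of_set (Y r0)) subshift_action" by (rule subshift_minimal[OF sub])
    moreover have "free_flow G (top_of_set (Y r0)) subshift_action" by (rule subshift_free[OF sub Y(2)])
    moreover have "disjoint_flows G X a (top_of_set (Y r0)) subshift_action"
      by (rule subshift_disjoint[OF flow sub visit])
    ultimately show "\<exists>(Y :: (nat \<Rightarrow> real) topology) b. minimal_flow G Y b \<and> metrizable_space Y \<and>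
        free_flow G Y b \<and> disjoint_flows G X a Y b"
      using metrizable_subshift by blast
  next
    interpret pt: nat_flow mul e iv "discrete_topology {()}" "\<lambda>_ _. ()"
      by unfold_locales (auto simp: compact_space_discrete_topology)
    obtain Y :: "(nat \<Rightarrow> bool) \<Rightarrow> (nat \<Rightarrow> real) set" where Y: "\<And>r. subshift (Y r)"
      "\<And>r. acts_freely (Y r)" "pt.jointly_minimal Y"
      using pt.exists_branches[of "\<lambda>_. {()}"] by auto
    define Xs where "Xs x = Y (cut x)" for x
    have sub: "subshift (Xs x)" for x using Y(1) by (simp add: Xs_def)
    have visit: "\<exists>t. \<forall>x\<in>J. pre M (act t (y x)) (v x)"
      if J: "finite J" and y: "\<And>x. x \<in> J \<Longrightarrow> y x \<in> Xs x" and v: "\<And>x. x \<in> J \<Longrightarrow> v x \<in> Xs x" for J y v M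
    proof -
      have inv: "inv_into UNIV cut (cut x) = x" for x using inj_cut by simp
      have "\<exists>t. () \<in> {()} \<and> (\<forall>r\<in>cut ` J. pre M (act t (y (inv_into UNIV cut r))) (v (inv_into UNIV cut r)))"
        by (rule pt.jointly_minimalD[OF Y(3), where x = "()"]) (use J y v inv in \<open>auto simp: Xs_def\<close>)
      then show ?thesis using inv by auto
    qed
    have "\<exists>t. pre M (act t y) v" if "y \<in> Xs x" "v \<in> Xs x" for x y v M
      using visit[of "{x}" "\<lambda>_. y" "\<lambda>_. v" M] that by auto
    then have min: "minimal_flow G (top_of_set (Xs x)) subshift_action" for x
      using subshift_minimal[OF sub] by blast
    have free: "free_flow G (top_of_set (Xs x)) subshift_action" for x
      using subshift_free[OF sub] Y(2) by (simp add: Xs_def)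
    have "minimal_flow G (product_topology (\<lambda>x. top_of_set (Xs x)) UNIV) (diag_action UNIV (\<lambda>_. subshift_action))"
      by (rule product_of_subshifts_minimal[OF sub]) (rule visit)
    with min have "mutually_disjoint G UNIV (\<lambda>x. top_of_set (Xs x)) (\<lambda>_. subshift_action)"
      unfolding mutually_disjoint_def by blast
    then show "\<exists>(Xs :: real \<Rightarrow> (nat \<Rightarrow> real) topology) as. mutually_disjoint G UNIV Xs as \<and>
        (\<forall>r. free_flow G (Xs r) (as r) \<and> metrizable_space (Xs r) \<and> minimal_flow G (Xs r) (as r))"
      using min free metrizable_subshift
      by (intro exI[of _ "\<lambda>x. top_of_set (Xs x)"] exI[of _ "\<lambda>_. subshift_action"]) auto
  qed
qed

end
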